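(* There exist absolute constants $0<\alpha_1\le \alpha_2$, $\beta>0$ and $\gamma>0$ such that the following holds for all sufficiently large $n$. For every $\epsilon\in(0,1)$ with $\epsilon\ge 1/\sqrt{n}$ there exist $\epsilon_1,\epsilon_2$ with $\alpha_1\epsilon\le\epsilon_1\le\alpha_2\epsilon$ and $\epsilon_2-\epsilon_1\ge \beta\epsilon$ such that every non-adaptive $(\epsilon_1,\epsilon_2)$-tolerant tester for monotonicity of functions $f:\{0,1\}^n\to\{0,1\}$ must make at least $2^{\gamma n^{1/4}/\sqrt{\epsilon}}$ queries. The same lower bound holds for non-adaptive $(\epsilon_1,\epsilon_2)$-tolerant testers for unateness.
   Context: For $f,g:\{0,1\}^n\to\{0,1\}$, $\mathrm{dist}(f,g)=\Pr_{x\sim\{0,1\}^n}[f(x)\ne g(x)]$ with $x$ uniform; for a class $\mathcal P$ of functions, $\mathrm{dist}(f,\mathcal P)=\min_{g\in\mathcal P}\mathrm{dist}(f,g)$. A function is monotone if $f(x)\le f(y)$ whenever $x\le y$ coordinatewise; it is unate if there is $r\in\{0,1\}^n$ such that $x\mapsto f(x\oplus r)$ is monotone. For $0\le\epsilon_1<\epsilon_2$, an $(\epsilon_1,\epsilon_2)$-tolerant tester for $\mathcal P$ is a randomized algorithm with query access to $f$ that accepts with probability at least $2/3$ whenever $\mathrm{dist}(f,\mathcal P)\le\epsilon_1$ and rejects with probability at least $2/3$ whenever $\mathrm{dist}(f,\mathcal P)\ge\epsilon_2$. A tester is non-adaptive if its query points are chosen (possibly randomly) before seeing any answers. *)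

theory Defs
  imports "HOL-Probability.Probability"
begin

text \<open>Points of the hypercube {0,1}^n are represented as subsets of {..<n}
  (x_i = 1 iff i is in x). Boolean functions are maps nat set => bool;
  only their values on the cube matter.\<close>

definition cube :: "nat \<Rightarrow> nat set set" where
  "cube n = Pow {..<n}"

definition bdist :: "nat \<Rightarrow> (nat set \<Rightarrow> bool) \<Rightarrow> (nat set \<Rightarrow> bool) \<Rightarrow> real" where
  "bdist n f g = real (card {x \<in> cube n. f x \<noteq> g x}) / 2 ^ n"

definition dist_class :: "nat \<Rightarrow> ((nat set \<Rightarrow> bool) \<Rightarrow> bool) \<Rightarrow> (nat set \<Rightarrow> bool) \<Rightarrow> real" where
  "dist_class n P f = Inf {bdist n f g | g. P g}"

definition monotone_bf :: "nat \<Rightarrow> (nat set \<Rightarrow> bool) \<Rightarrow> bool" where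
  "monotone_bf n f \<longleftrightarrow> (\<forall>x\<in>cube n. \<forall>y\<in>cube n. x \<subseteq> y \<longrightarrow> f x \<le> f y)"

definition unate_bf :: "nat \<Rightarrow> (nat set \<Rightarrow> bool) \<Rightarrow> bool" where
  "unate_bf n f \<longleftrightarrow> (\<exists>r\<in>cube n. monotone_bf n (\<lambda>x. f ((x - r) \<union> (r - x))))"

type_synonym na_tester = "((nat set) list \<times> (bool list \<Rightarrow> bool)) pmf"

definition accept_prob :: "na_tester \<Rightarrow> (nat set \<Rightarrow> bool) \<Rightarrow> real" where
  "accept_prob T f = measure_pmf.prob T {(Q, d). d (map f Q)}"

definition nonadaptive_tester :: "nat \<Rightarrow> nat \<Rightarrow> na_tester \<Rightarrow> bool" where
  "nonadaptive_tester n q T \<longleftrightarrow>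
     (\<forall>(Q, d)\<in>set_pmf T. length Q \<le> q \<and> set Q \<subseteq> cube n)"

definition tolerant_tester ::
  "nat \<Rightarrow> ((nat set \<Rightarrow> bool) \<Rightarrow> bool) \<Rightarrow> real \<Rightarrow> real \<Rightarrow> na_tester \<Rightarrow> bool" where
  "tolerant_tester n P e1 e2 T \<longleftrightarrow>
     (\<forall>f. dist_class n P f \<le> e1 \<longrightarrow> accept_prob T f \<ge> 2/3) \<and>
     (\<forall>f. dist_class n P f \<ge> e2 \<longrightarrow> accept_prob T f \<le> 1/3)"

end

theory Submission
  imports Defs
begin

text \<open>Split the coordinates into \<open>2 s\<close> action variables, with \<open>s\<close> of order \<open>\<surd>n / \<epsilon>\<close>, two switch
  coordinates and control variables. A random family of \<open>2 ^ (w - 1)\<close> conjunctions of \<open>w = 8 s\<close> control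
  variables (Talagrand's random DNF) assigns an identifier, the unique satisfied conjunction, to a
  constant fraction of the inputs in the \<open>\<approx> \<epsilon> \<surd>n\<close> layers just below the middle of the control cube, hence
  to a \<open>\<Theta>(\<epsilon>)\<close> fraction of all inputs. An identifier with secret bit \<open>\<beta>\<close> gets a function of the action
  variables that is \<open>\<beta>\<close> on the layers \<open>\<ge> s + k\<close>, \<open>0\<close> on the thin middle band, and on the layers \<open>\<le> s - k\<close>
  equals \<open>\<beta>\<close> in the close family and \<open>\<not> \<beta>\<close> in the far family. The first is nearly constant. In the
  second a threshold and a reversed threshold occur equally often, and by Harris' inequality no
  single orientation of the action variables makes both of them close to monotone.

  The two families are told apart only by two queries with the same identifier, one of them low and one
  high on the action variables. If the queries differ in \<open>D\<close>, this requires \<open>2 k\<close> action variables in \<open>D\<close>,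
  while sharing a conjunction has probability at most \<open>exp (- w d / c)\<close> where \<open>d\<close> of the \<open>c\<close> control
  variables lie in \<open>D\<close>. Averaged over a random choice of one action variable per block of coordinates
  this is at most \<open>2 ^ (- 2 k)\<close>, and \<open>k\<close> of order \<open>\<surd>s\<close> is permitted.\<close>

section \<open>Harris' inequality and middle binomial coefficients\<close>

text \<open>Induction on the ground set. Splitting off one element leaves two half-sums of
  \<open>f\<close> and two of \<open>g\<close>, ordered in opposite ways, and for two terms the
  claim is Chebyshev's sum inequality \<open>(f1 - f0) * (g1 - g0) \<le> 0\<close>.\<close>

lemma harris_antitone:
  fixes f g :: "'a set \<Rightarrow> real"
  assumes "finite N"
    and "\<And>u v. u \<subseteq> v \<Longrightarrow> v \<subseteq> N \<Longrightarrow> f u \<le> f v"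
    and "\<And>u v. u \<subseteq> v \<Longrightarrow> v \<subseteq> N \<Longrightarrow> g v \<le> g u"
  shows "2 ^ card N * (\<Sum>u\<in>Pow N. f u * g u) \<le> (\<Sum>u\<in>Pow N. f u) * (\<Sum>u\<in>Pow N. g u)"
  using assms
proof (induction N arbitrary: f g rule: finite_induct)
  case empty
  then show ?case by simp
next
  case (insert x N)
  have split: "(\<Sum>u\<in>Pow (insert x N). h u) = (\<Sum>u\<in>Pow N. h u) + (\<Sum>u\<in>Pow N. h (insert x u))"
    for h :: "'a set \<Rightarrow> real"
  proof -
    have "(\<Sum>u\<in>insert x ` Pow N. h u) = (\<Sum>u\<in>Pow N. h (insert x u))"
      by (subst sum.reindex) (use insert.hyps in \<open>auto simp: inj_on_def\<close>)
    moreover have "(\<Sum>u\<in>Pow (insert x N). h u) = (\<Sum>u\<in>Pow N. h u) + (\<Sum>u\<in>insert x ` Pow N. h u)"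
      unfolding Pow_insert by (rule sum.union_disjoint) (use insert.hyps in auto)
    ultimately show ?thesis by simp
  qed
  define f0 f1 g0 g1 where "f0 = (\<Sum>u\<in>Pow N. f u)" "f1 = (\<Sum>u\<in>Pow N. f (insert x u))"
    "g0 = (\<Sum>u\<in>Pow N. g u)" "g1 = (\<Sum>u\<in>Pow N. g (insert x u))"
  have 0: "2 ^ card N * (\<Sum>u\<in>Pow N. f u * g u) \<le> f0 * g0"
    unfolding f0_f1_g0_g1_def
  proof (rule insert.IH)
    fix u v assume "u \<subseteq> v" "v \<subseteq> N"
    then have "u \<subseteq> v" "v \<subseteq> insert x N" by auto
    then show "f u \<le> f v" "g v \<le> g u"
      using insert.prems by blast+
  qed
  have 1: "2 ^ card N * (\<Sum>u\<in>Pow N. f (insert x u) * g (insert x u)) \<le> f1 * g1"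
    unfolding f0_f1_g0_g1_def
  proof (rule insert.IH[of "\<lambda>u. f (insert x u)" "\<lambda>u. g (insert x u)"])
    fix u v assume "u \<subseteq> v" "v \<subseteq> N"
    then have "insert x u \<subseteq> insert x v" "insert x v \<subseteq> insert x N" by auto
    then show "f (insert x u) \<le> f (insert x v)" "g (insert x v) \<le> g (insert x u)"
      using insert.prems by blast+
  qed
  have "f u \<le> f (insert x u) \<and> g (insert x u) \<le> g u" if "u \<in> Pow N" for u
  proof -
    have "u \<subseteq> insert x u" "insert x u \<subseteq> insert x N" using that by auto
    then show ?thesis using insert.prems by blast
  qed
  then have "f0 \<le> f1" "g1 \<le> g0"
    unfolding f0_f1_g0_g1_def by (auto intro: sum_mono)
  then have "(f1 - f0) * (g1 - g0) \<le> 0"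
    by (simp add: mult_nonneg_nonpos)
  moreover have "2 ^ card (insert x N) * (\<Sum>u\<in>Pow (insert x N). f u * g u) \<le> 2 * (f0 * g0 + f1 * g1)"
    using 0 1 insert.hyps by (simp add: split algebra_simps)
  ultimately have "2 ^ card (insert x N) * (\<Sum>u\<in>Pow (insert x N). f u * g u) \<le> (f0 + f1) * (g0 + g1)"
    by (simp add: algebra_simps)
  then show ?case
    by (simp add: split f0_f1_g0_g1_def)
qed

section \<open>Middle binomial coefficients up to constant factors\<close>

lemma central_binomial_Suc: "Suc m * (2 * Suc m choose Suc m) = 2 * (2 * m + 1) * (2 * m choose m)"
proof -
  have 1: "Suc m * (Suc (Suc (2 * m)) choose Suc m) = Suc (Suc (2 * m)) * (Suc (2 * m) choose m)"
    by (rule Suc_times_binomial)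
  have "Suc (2 * m) choose m = Suc (2 * m) choose Suc m"
    by (subst binomial_symmetric) auto
  moreover have 2: "Suc m * (Suc (2 * m) choose Suc m) = Suc (2 * m) * (2 * m choose m)"
    by (rule Suc_times_binomial)
  ultimately show ?thesis using 1 by (simp add: algebra_simps)
qed

text \<open>Elementary substitute for Stirling's formula. Relative to \<open>16 ^ m\<close>, the
  quantity bounded above decreases in \<open>m\<close> and the one bounded below increases: the
  consecutive quotients are (2m+1)(2m+3)/(4(m+1)^2) and (2m+1)^2/(4m(m+1)).\<close>

lemma central_binomial_sq_bounds:
  "(real (2 * m choose m))\<^sup>2 * (2 * m + 1) \<le> 16 ^ m"
  "m \<ge> 1 \<Longrightarrow> 16 ^ m \<le> (real (2 * m choose m))\<^sup>2 * (4 * m)"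
proof -
  define c where "c m = real (2 * m choose m)" for m :: nat
  have rec: "(m + 1) * c (Suc m) = 2 * (2 * m + 1) * c m" for m :: nat
    unfolding c_def using arg_cong[OF central_binomial_Suc, of real m] by (simp only: of_nat_mult of_nat_Suc) simp
  have rec2: "c (Suc m) = 2 * (2 * m + 1) / (m + 1) * c m" for m :: nat
    using rec[of m] by (simp add: field_simps)
  have "(c m)\<^sup>2 * (2 * m + 1) \<le> 16 ^ m"
  proof (induction m)
    case 0
    then show ?case by (simp add: c_def)
  next
    case (Suc m)
    have "(c (Suc m))\<^sup>2 * (2 * Suc m + 1) = 16 * ((c m)\<^sup>2 * (2 * m + 1)) * ((2 * real m + 1) * (2 * m + 3) / (4 * (m + 1)^2))"
    proof -
      define d where "d = real m + 1"
      have "d \<noteq> 0" by (simp add: d_def)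
      have e: "real m = d - 1" "real (m + 1) = d" by (simp_all add: d_def)
      show ?thesis using \<open>d \<noteq> 0\<close> unfolding rec2
        by (simp add: e field_simps power2_eq_square)
    qed
    also have "\<dots> \<le> 16 * ((c m)\<^sup>2 * (2 * m + 1)) * 1"
    proof (intro mult_left_mono)
      have "(2 * real m + 1) * (2 * m + 3) \<le> 4 * (real m + 1)^2"
        by (simp add: algebra_simps power2_eq_square)
      then show "(2 * real m + 1) * (2 * m + 3) / (4 * (m + 1)^2) \<le> 1"
        by (subst divide_le_eq_1_pos) (auto simp: add.commute)
    qed auto
    also have "\<dots> \<le> 16 ^ Suc m" using Suc by simp
    finally show ?case .
  qed
  then show "(real (2 * m choose m))\<^sup>2 * (2 * m + 1) \<le> 16 ^ m"
    by (simp add: c_def)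
  have "16 ^ m \<le> (c m)\<^sup>2 * (4 * m)" if "m \<ge> 1"
    using that
  proof (induction m rule: nat_induct_at_least)
    case base
    then show ?case by (simp add: c_def power2_eq_square numeral_eq_Suc)
  next
    case (Suc m)
    have "16 ^ Suc m \<le> 16 * ((c m)\<^sup>2 * (4 * m)) * 1"
      using Suc by (simp add: mult_ac)
    also have "\<dots> \<le> 16 * ((c m)\<^sup>2 * (4 * m)) * ((2 * real m + 1)^2 / (4 * m * (real m + 1)))"
    proof (intro mult_left_mono)
      have "1 \<le> (2 * M + 1)^2 / (4 * M * (M + 1))" if "M > 0" for M :: real
        using that by (subst le_divide_eq_1_pos) (simp_all add: power2_eq_square algebra_simps add_pos_pos)
      from this[of "real m"] show "1 \<le> (2 * real m + 1)^2 / (4 * m * (real m + 1))"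
        using Suc.hyps by simp
    qed simp
    also have "\<dots> = (c (Suc m))\<^sup>2 * (4 * Suc m)"
    proof -
      have gen: "16 * (C^2 * (4 * M)) * ((2 * M + 1)^2 / (4 * M * d)) = (2 * (2 * M + 1) / d * C)^2 * (4 * d)"
        if "M \<noteq> 0" "d \<noteq> 0" for C M d :: real
        using that by (simp add: field_simps power2_eq_square)
      have "c (Suc m) = 2 * (2 * real m + 1) / (real m + 1) * c m" using rec2[of m] by (simp add: add.commute)
      then show ?thesis using gen[of "real m" "real m + 1" "c m"] Suc.hyps
        by (simp only: of_nat_Suc add.commute[of 1]) simp
    qed
    finally show ?case .
  qed
  then show "m \<ge> 1 \<Longrightarrow> 16 ^ m \<le> (real (2 * m choose m))\<^sup>2 * (4 * m)"
    by (simp add: c_def)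
qed

lemma middle_binomial_odd: "2 * ((2 * m + 1) choose m) = 2 * (m + 1) choose (m + 1)"
proof -
  have "Suc m * (Suc (Suc (2 * m)) choose Suc m) = Suc (Suc (2 * m)) * (Suc (2 * m) choose m)"
    by (rule Suc_times_binomial)
  then have "Suc m * (2 * (m + 1) choose (m + 1)) = Suc m * (2 * ((2 * m + 1) choose m))"
    by simp
  then show ?thesis by (simp only: mult_cancel1) simp
qed

text \<open>Even rows are the central case. The middle coefficient of row 2m+1 is half the central
  one of row 2m+2, and the constants leave room for both parities.\<close>

lemma middle_binomial_sq_bounds:
  assumes "c \<ge> 1"
  shows "(real (c choose (c div 2)))\<^sup>2 * c \<le> 4 ^ c"
    and "4 ^ c \<le> (real (c choose (c div 2)))\<^sup>2 * (4 * c)"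
proof -
  define m where "m = c div 2"
  have "(real (c choose (c div 2)))\<^sup>2 * c \<le> 4 ^ c \<and> 4 ^ c \<le> (real (c choose (c div 2)))\<^sup>2 * (4 * c)"
  proof (cases "even c")
    case True
    then have c: "c = 2 * m" and "m \<ge> 1" using assms by (auto simp: m_def)
    have p: "(4::real) ^ c = 16 ^ m" by (simp add: c power_mult)
    define q where "q = (real (2 * m choose m))\<^sup>2"
    have "0 \<le> q * real m" "0 \<le> q" "q * real (2 * m) = 2 * (q * real m)"
      "q * real (4 * (2 * m)) = 8 * (q * real m)" "q * real (4 * m) = 4 * (q * real m)"
      "q * real (2 * m + 1) = 2 * (q * real m) + q"
      by (simp_all add: q_def algebra_simps)
    then have "q * real (2 * m) \<le> 16 ^ m \<and> 16 ^ m \<le> q * real (4 * (2 * m))"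
      using central_binomial_sq_bounds[of m] \<open>m \<ge> 1\<close> unfolding q_def[symmetric] by linarith
    then show ?thesis unfolding p q_def unfolding c by simp
  next
    case False
    then have c: "c = 2 * m + 1" by (simp add: m_def)
    then have d: "c div 2 = m" by simp
    have p: "4 * (4::real) ^ c = 16 ^ (m + 1)" by (simp add: c power_mult)
    have q: "(real (2 * (m + 1) choose (m + 1)))\<^sup>2 = 4 * (real (c choose m))\<^sup>2"
      unfolding middle_binomial_odd[symmetric] c by (simp add: power_mult_distrib)
    have "(real (c choose m))\<^sup>2 * c \<le> (real (c choose m))\<^sup>2 * (2 * (m + 1) + 1)"
      "(real (c choose m))\<^sup>2 * (4 * (m + 1)) \<le> (real (c choose m))\<^sup>2 * (4 * c)"
      unfolding c by (intro mult_left_mono; simp)+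
    then show ?thesis
      using central_binomial_sq_bounds[of "m + 1"] unfolding q p[symmetric] d
      by (simp add: algebra_simps)
  qed
  then show "(real (c choose (c div 2)))\<^sup>2 * c \<le> 4 ^ c"
    and "4 ^ c \<le> (real (c choose (c div 2)))\<^sup>2 * (4 * c)" by auto
qed

lemma middle_binomial_bounds:
  assumes "c \<ge> 1"
  shows "real (c choose (c div 2)) \<le> 2 ^ c / sqrt c"
    and "2 ^ c / (2 * sqrt c) \<le> real (c choose (c div 2))"
proof -
  have p: "sqrt (4 ^ c) = 2 ^ c"
    by (simp add: real_sqrt_power)
  have "real (c choose (c div 2)) * sqrt c = sqrt ((real (c choose (c div 2)))\<^sup>2 * c)"
    by (simp add: real_sqrt_mult)
  also have "\<dots> \<le> sqrt (4 ^ c)" using middle_binomial_sq_bounds(1)[OF assms] by (intro real_sqrt_le_mono)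
  finally show "real (c choose (c div 2)) \<le> 2 ^ c / sqrt c"
    using assms unfolding p by (simp add: field_simps)
  have "sqrt (4 ^ c) \<le> sqrt ((real (c choose (c div 2)))\<^sup>2 * (4 * c))"
    using middle_binomial_sq_bounds(2)[OF assms] by (intro real_sqrt_le_mono)
  also have "\<dots> = real (c choose (c div 2)) * (2 * sqrt c)"
    by (simp add: real_sqrt_mult)
  finally show "2 ^ c / (2 * sqrt c) \<le> real (c choose (c div 2))"
    using assms unfolding p by (simp add: field_simps)
qed

text \<open>One step down multiplies the coefficient by at least 1 - 4(j+1)/c. Measured against the
  largest coefficient the losses simply add up, and 4j^2 + 4(j+1) is at most 4(j+1)^2.\<close>

lemma near_middle_binomial:
  fixes c j :: nat
  assumes "j \<le> c div 2"
  shows "(1 - 4 * real j ^ 2 / c) * real (c choose (c div 2)) \<le> real (c choose (c div 2 - j))"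
  using assms
proof (induction j)
  case 0
  then show ?case by simp
next
  case (Suc j)
  define b where "b i = real (c choose (c div 2 - i))" for i
  define d where "d = c - (c div 2 - Suc j)"
  have c: "c \<ge> 2" and d: "Suc (c div 2 - Suc j) = c div 2 - j" "real d \<ge> c / 2" "d > 0"
    "real (c div 2 - j) = real d - (c - 2 * (c div 2)) - 2 * j - 1"
    using Suc.prems by (auto simp: d_def)
  have "(c div 2 - j) * (c choose (c div 2 - j)) = c * (c - 1 choose (c div 2 - Suc j))"
    unfolding d(1)[symmetric] by (rule binomial_absorption)
  then have "(c div 2 - j) * (c choose (c div 2 - j)) = d * (c choose (c div 2 - Suc j))"
    unfolding d_def binomial_absorb_comp .
  then have "real (c div 2 - j) * b j = real d * b (Suc j)"
    unfolding b_def by (simp only: of_nat_mult [symmetric])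
  then have step: "b (Suc j) = (real (c div 2 - j) / d) * b j"
    using \<open>d > 0\<close> by (simp add: field_simps)
  \<comment> \<open>The numerator falls short of \<open>d\<close> by at most 2j+2, one unit of which
    is due to odd \<open>c\<close>, and \<open>d\<close> is at least c/2.\<close>
  have "1 - 4 * real (Suc j) / c \<le> real (c div 2 - j) / d"
  proof -
    have "(2 + 2 * real j) / d \<le> (2 + 2 * real j) / (c / 2)"
      using d c by (intro divide_left_mono) auto
    moreover have "real (c div 2 - j) / d \<ge> (real d - (2 + 2 * real j)) / d"
      unfolding d(4) by (intro divide_right_mono) linarith+
    moreover have "(real d - (2 + 2 * real j)) / d = 1 - (2 + 2 * real j) / d"
      using d by (simp add: field_simps)
    moreover have "(2 + 2 * real j) / (c / 2) = 4 * real (Suc j) / c" by (simp add: field_simps)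
    ultimately show ?thesis by linarith
  qed
  then have "(1 - 4 * real (Suc j) / c) * b j \<le> b (Suc j)"
    unfolding step by (intro mult_right_mono) (auto simp: b_def)
  moreover have "b j \<le> b 0" unfolding b_def using binomial_maximum by simp
  then have "4 * real (Suc j) / c * b j \<le> 4 * real (Suc j) / c * b 0"
    by (intro mult_left_mono) auto
  moreover have "(1 - 4 * real j ^ 2 / c) * b 0 \<le> b j"
    using Suc unfolding b_def by simp
  ultimately have "(1 - 4 * real j ^ 2 / c) * b 0 - 4 * real (Suc j) / c * b 0 \<le> b (Suc j)"
    by (simp only: left_diff_distrib)
  moreover have "(1 - 4 * real (Suc j) ^ 2 / c) * b 0 \<le> (1 - 4 * real j ^ 2 / c - 4 * real (Suc j) / c) * b 0"
  proof (intro mult_right_mono)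
    have "4 * real j ^ 2 / c + 4 * real (Suc j) / c = (4 * real j ^ 2 + 4 * real (Suc j)) / c"
      by (simp add: add_divide_distrib)
    also have "\<dots> \<le> 4 * real (Suc j) ^ 2 / c"
      by (intro divide_right_mono) (auto simp: power2_eq_square algebra_simps)
    finally show "1 - 4 * real (Suc j) ^ 2 / c \<le> 1 - 4 * real j ^ 2 / c - 4 * real (Suc j) / c" by linarith
  qed (simp add: b_def)
  ultimately have "(1 - 4 * real (Suc j) ^ 2 / c) * b 0 \<le> b (Suc j)"
    by (simp only: left_diff_distrib)
  then show ?case by (simp add: b_def)
qed

section \<open>Opposite thresholds under a common orientation\<close>

lemma card_Collect_involution:
  assumes "\<And>u. u \<in> S \<Longrightarrow> \<phi> u \<in> S" "\<And>u. u \<in> S \<Longrightarrow> \<phi> (\<phi> u) = u"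
  shows "card {u \<in> S. Q (\<phi> u)} = card {u \<in> S. Q u}"
proof (rule bij_betw_same_card[of \<phi>], rule bij_betw_byWitness[where f' = \<phi>])
  show "\<phi> ` {u \<in> S. Q (\<phi> u)} \<subseteq> {u \<in> S. Q u}"
    using assms(1) by blast
  show "\<phi> ` {u \<in> S. Q u} \<subseteq> {u \<in> S. Q (\<phi> u)}"
    using assms by force
qed (simp_all add: assms(2))

lemma card_Pow_Un_Collect:
  assumes "finite P" "finite N" "P \<inter> N = {}"
  shows "card {u \<in> Pow (P \<union> N). Q u} = (\<Sum>v\<in>Pow P. card {w \<in> Pow N. Q (v \<union> w)})"
proof -
  have "card {u \<in> Pow (P \<union> N). Q u} = card (SIGMA v:Pow P. {w \<in> Pow N. Q (v \<union> w)})"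
  proof (rule bij_betw_same_card[symmetric], rule bij_betw_byWitness[where f' = "\<lambda>u. (u \<inter> P, u \<inter> N)"])
    show "\<forall>p\<in>SIGMA v:Pow P. {w \<in> Pow N. Q (v \<union> w)}.
        ((case p of (v, w) \<Rightarrow> v \<union> w) \<inter> P, (case p of (v, w) \<Rightarrow> v \<union> w) \<inter> N) = p"
      using assms(3) by auto
    show "\<forall>u\<in>{u \<in> Pow (P \<union> N). Q u}. (case (u \<inter> P, u \<inter> N) of (v, w) \<Rightarrow> v \<union> w) = u"
      by auto
    show "(\<lambda>(v, w). v \<union> w) ` (SIGMA v:Pow P. {w \<in> Pow N. Q (v \<union> w)}) \<subseteq> {u \<in> Pow (P \<union> N). Q u}"
      by auto
    have "u \<inter> P \<union> u \<inter> N = u" if "u \<subseteq> P \<union> N" for u using that by auto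
    then show "(\<lambda>u. (u \<inter> P, u \<inter> N)) ` {u \<in> Pow (P \<union> N). Q u} \<subseteq> (SIGMA v:Pow P. {w \<in> Pow N. Q (v \<union> w)})"
      by auto
  qed
  also have "\<dots> = (\<Sum>v\<in>Pow P. card {w \<in> Pow N. Q (v \<union> w)})"
    using assms by (subst card_SigmaI) auto
  finally show ?thesis .
qed

text \<open>The sum over \<open>N\<close> of the sign +1 on \<open>u\<close> and -1 off
  \<open>u\<close>. It is an integer for either parity of \<open>card N\<close>, and complementation
  negates it.\<close>

definition imbalance :: "'a set \<Rightarrow> 'a set \<Rightarrow> int" where
  "imbalance N u = 2 * int (card (u \<inter> N)) - int (card N)"

lemma imbalance_mono:
  assumes "finite N" "u \<subseteq> v"
  shows "imbalance N u \<le> imbalance N v"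
  unfolding imbalance_def using assms by (auto intro!: card_mono)

lemma imbalance_compl:
  assumes "finite N" "N \<subseteq> A"
  shows "imbalance N (A - u) = - imbalance N u"
proof -
  have "(A - u) \<inter> N = N - u \<inter> N" using assms by auto
  then have "card ((A - u) \<inter> N) = card N - card (u \<inter> N)"
    using assms by (simp add: card_Diff_subset)
  moreover have "card (u \<inter> N) \<le> card N" using assms by (auto intro: card_mono)
  ultimately show ?thesis by (simp add: imbalance_def)
qed

text \<open>By Harris' inequality an antitone predicate holds at least as often on a low layer set as
  on the complementary high one, so it has to disagree with a threshold function there.\<close>
lemma antitone_layers:
  fixes G :: "'a set \<Rightarrow> bool"
  assumes N: "finite N" and G: "\<And>u v. u \<subseteq> v \<Longrightarrow> v \<subseteq> N \<Longrightarrow> G v \<Longrightarrow> G u"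
  shows "card {w \<in> Pow N. t \<le> imbalance N w} \<le>
    card {w \<in> Pow N. t \<le> imbalance N w \<and> \<not> G w} + card {w \<in> Pow N. imbalance N w \<le> - t \<and> G w}"
proof -
  define up down where "up = {w \<in> Pow N. t \<le> imbalance N w}" "down = {w \<in> Pow N. imbalance N w \<le> - t}"
  define Gs where "Gs = {w \<in> Pow N. G w}"
  have fin: "finite up" "finite down" "finite Gs" using N by (simp_all add: up_down_def Gs_def)
  have cnt: "(\<Sum>u\<in>Pow N. of_bool (Q u)) = real (card {u \<in> Pow N. Q u})" for Q
    using N by (simp add: of_bool_def sum.If_cases Int_def)
  have mono: "(of_bool (t \<le> imbalance N u) :: real) \<le> of_bool (t \<le> imbalance N v)"
    "(- of_bool (imbalance N u \<le> - t) :: real) \<le> - of_bool (imbalance N v \<le> - t)"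
    "(of_bool (G v) :: real) \<le> of_bool (G u)" if "u \<subseteq> v" "v \<subseteq> N" for u v
    using imbalance_mono[OF N that(1)] G[OF that] by auto
  have "2 ^ card N * (\<Sum>u\<in>Pow N. of_bool (t \<le> imbalance N u) * of_bool (G u))
      \<le> (\<Sum>u\<in>Pow N. of_bool (t \<le> imbalance N u)) * (\<Sum>u\<in>Pow N. of_bool (G u) :: real)"
    by (intro harris_antitone N mono(1) mono(3))
  then have 1: "2 ^ card N * real (card (up \<inter> Gs)) \<le> real (card up) * real (card Gs)"
    by (simp add: cnt up_down_def Gs_def Int_def conj_ac flip: of_bool_conj)
  \<comment> \<open>The indicator of the low layers is antitone, so Harris' inequality is applied to
    its negative, which reverses the conclusion.\<close>
  have "2 ^ card N * (\<Sum>u\<in>Pow N. (- of_bool (imbalance N u \<le> - t)) * of_bool (G u))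
      \<le> (\<Sum>u\<in>Pow N. - of_bool (imbalance N u \<le> - t)) * (\<Sum>u\<in>Pow N. of_bool (G u) :: real)"
    by (intro harris_antitone N mono(2) mono(3))
  then have 2: "real (card down) * real (card Gs) \<le> 2 ^ card N * real (card (down \<inter> Gs))"
    by (simp add: cnt up_down_def Gs_def Int_def conj_ac sum_negf flip: of_bool_conj)
  have eq: "card up = card down"
    unfolding up_down_def using imbalance_compl[OF N order_refl]
    by (subst card_Collect_involution[where \<phi> = "\<lambda>u. N - u" and S = "Pow N", symmetric])
       (auto simp: double_diff)
  have "2 ^ card N * real (card (up \<inter> Gs)) \<le> 2 ^ card N * real (card (down \<inter> Gs))"
    using 1 2 unfolding eq by (rule order_trans)
  then have "card (up \<inter> Gs) \<le> card (down \<inter> Gs)" by (simp del: of_nat_mult)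
  moreover have "card up = card (up \<inter> Gs) + card (up - Gs)"
    using fin by (subst card_Un_disjoint[symmetric]) (auto simp: Int_Diff_Un)
  moreover have "up - Gs = {w \<in> Pow N. t \<le> imbalance N w \<and> \<not> G w}" "down \<inter> Gs = {w \<in> Pow N. imbalance N w \<le> - t \<and> G w}"
    by (auto simp: up_down_def Gs_def)
  ultimately show ?thesis by (simp add: up_down_def)
qed

lemma threshold_antitone_mismatch:
  assumes fin: "finite P" "finite N" and disj: "P \<inter> N = {}"
    and card: "card (P \<union> N) = 2 * s" and k: "k \<ge> 1"
    and anti: "\<And>u u'. u \<subseteq> u' \<Longrightarrow> u' \<subseteq> P \<union> N \<Longrightarrow> u' - u \<subseteq> N \<Longrightarrow> g u' \<Longrightarrow> g u"
  shows "card {u \<in> Pow (P \<union> N). \<bar>imbalance P u\<bar> + 2 * int k \<le> imbalance N u} \<le>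
    card {u \<in> Pow (P \<union> N). (s + k \<le> card u) \<noteq> g u}"
  unfolding card_Pow_Un_Collect[OF fin disj]
proof (rule sum_mono)
  fix v assume v: "v \<in> Pow P"
  define t where "t = \<bar>imbalance P v\<bar> + 2 * int k"
  have imb: "imbalance P (v \<union> w) = imbalance P v" "imbalance N (v \<union> w) = imbalance N w" if "w \<in> Pow N" for w
  proof -
    have "(v \<union> w) \<inter> P = v \<inter> P" "(v \<union> w) \<inter> N = w \<inter> N" using that v disj by auto
    then show "imbalance P (v \<union> w) = imbalance P v" "imbalance N (v \<union> w) = imbalance N w"
      by (simp_all add: imbalance_def)
  qed
  have size: "(s + k \<le> card (v \<union> w)) \<longleftrightarrow> 2 * int k \<le> imbalance P v + imbalance N w" if "w \<in> Pow N" for w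
  proof -
    have "v \<inter> P = v" "w \<inter> N = w" using that v by auto
    moreover have "card (v \<union> w) = card v + card w"
      using that v disj fin by (intro card_Un_disjoint) (auto intro: finite_subset)
    moreover have "card P + card N = 2 * s" using card fin disj by (simp add: card_Un_disjoint)
    ultimately show ?thesis unfolding imbalance_def by simp linarith
  qed
  have "card {w \<in> Pow N. \<bar>imbalance P (v \<union> w)\<bar> + 2 * int k \<le> imbalance N (v \<union> w)} = card {w \<in> Pow N. t \<le> imbalance N w}"
    by (rule arg_cong[of _ _ card]) (auto simp: t_def imb)
  also have "\<dots> \<le> card {w \<in> Pow N. t \<le> imbalance N w \<and> \<not> g (v \<union> w)} + card {w \<in> Pow N. imbalance N w \<le> - t \<and> g (v \<union> w)}"
    using v by (intro antitone_layers fin) (rule anti; auto)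
  also have "\<dots> = card ({w \<in> Pow N. t \<le> imbalance N w \<and> \<not> g (v \<union> w)} \<union> {w \<in> Pow N. imbalance N w \<le> - t \<and> g (v \<union> w)})"
    using fin by (intro card_Un_disjoint[symmetric]) auto
  also have "\<dots> \<le> card {w \<in> Pow N. (s + k \<le> card (v \<union> w)) \<noteq> g (v \<union> w)}"
  proof (rule card_mono)
    show "{w \<in> Pow N. t \<le> imbalance N w \<and> \<not> g (v \<union> w)} \<union> {w \<in> Pow N. imbalance N w \<le> - t \<and> g (v \<union> w)}
      \<subseteq> {w \<in> Pow N. (s + k \<le> card (v \<union> w)) \<noteq> g (v \<union> w)}"
      using k by (auto simp: size t_def)
  qed (use fin in simp)
  finally show "card {w \<in> Pow N. \<bar>imbalance P (v \<union> w)\<bar> + 2 * int k \<le> imbalance N (v \<union> w)}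
     \<le> card {w \<in> Pow N. (s + k \<le> card (v \<union> w)) \<noteq> g (v \<union> w)}" .
qed

text \<open>Sums instead of \<open>s - k\<close>, since subtraction of naturals truncates.\<close>

definition middle_band :: "nat \<Rightarrow> nat \<Rightarrow> nat set \<Rightarrow> nat set set" where
  "middle_band s k A = {u \<in> Pow A. s < card u + k \<and> card u < s + k}"

text \<open>Let X and Y be the imbalances on \<open>P = A - N\<close> and on \<open>N\<close>. The
  previous lemma yields mismatches with \<open>g\<close> where |X| + 2k \<le> Y and, after
  complementation, with \<open>g'\<close> where |Y| + 2k \<le> X. Up to a factor 2 these regions
  cover all points except those with |X + Y| < 2k or |X - Y| < 2k, two sets of the size of the
  middle band.\<close>

lemma opposite_thresholds_mismatch:
  assumes A: "finite A" "card A = 2 * s" and N: "N \<subseteq> A" and k: "k \<ge> 1"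
    and g: "\<And>u u'. u \<subseteq> u' \<Longrightarrow> u' \<subseteq> A \<Longrightarrow> u' - u \<subseteq> N \<Longrightarrow> g u' \<Longrightarrow> g u"
    and g': "\<And>u u'. u \<subseteq> u' \<Longrightarrow> u' \<subseteq> A \<Longrightarrow> u' - u \<subseteq> A - N \<Longrightarrow> g' u \<Longrightarrow> g' u'"
  shows "2 ^ (2 * s) \<le> 2 * (card {u \<in> Pow A. (s + k \<le> card u) \<noteq> g u} + card {u \<in> Pow A. (card u + k \<le> s) \<noteq> g' u})
           + 2 * card (middle_band s k A)"
proof -
  define P where "P = A - N"
  have PN: "P \<union> N = A" "N \<union> P = A" "P \<inter> N = {}" "N \<inter> P = {}" "finite P" "finite N" "P \<subseteq> A"
    using N A by (auto simp: P_def intro: finite_subset)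
  let ?X = "imbalance P" and ?Y = "imbalance N" and ?K = "2 * int k"
  have inv: "u \<in> Pow A \<Longrightarrow> A - u \<in> Pow A" "u \<in> Pow A \<Longrightarrow> A - (A - u) = u" for u by auto
  have sum: "?X u + ?Y u = 2 * int (card u) - 2 * int s" if "u \<in> Pow A" for u
  proof -
    have "u = (u \<inter> P) \<union> (u \<inter> N)" using PN that by auto
    then have "card u = card ((u \<inter> P) \<union> (u \<inter> N))" by simp
    also have "\<dots> = card (u \<inter> P) + card (u \<inter> N)"
      using PN by (intro card_Un_disjoint) auto
    finally have "card u = card (u \<inter> P) + card (u \<inter> N)" .
    moreover have "2 * s = card P + card N" using A PN card_Un_disjoint[of P N] by simp
    ultimately show ?thesis by (simp add: imbalance_def)
  qed
  have m1: "card {u \<in> Pow A. \<bar>?X u\<bar> + ?K \<le> ?Y u} \<le> card {u \<in> Pow A. (s + k \<le> card u) \<noteq> g u}"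
    using threshold_antitone_mismatch[of P N s k g] PN A k g by simp
  \<comment> \<open>Complementation turns the reversed threshold into the threshold and
    \<open>g'\<close> into a function antitone along \<open>P\<close>, so \<open>P\<close> and
    \<open>N\<close> exchange roles.\<close>
  have "card {u \<in> Pow A. \<bar>?Y u\<bar> + ?K \<le> ?X u} \<le> card {u \<in> Pow A. (s + k \<le> card u) \<noteq> g' (A - u)}"
  proof -
    have "g' (A - u)" if "u \<subseteq> u'" "u' \<subseteq> A" "u' - u \<subseteq> P" "g' (A - u')" for u u'
      by (rule g'[of "A - u'"]) (use that in \<open>auto simp: P_def\<close>)
    then show ?thesis
      using threshold_antitone_mismatch[of N P s k "\<lambda>u. g' (A - u)"] PN A k by simp
  qed
  also have "\<dots> = card {u \<in> Pow A. (card (A - u) + k \<le> s) \<noteq> g' (A - u)}"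
  proof -
    have "s + k \<le> card u \<longleftrightarrow> card (A - u) + k \<le> s" if "u \<in> Pow A" for u
    proof -
      have "card (A - u) = 2 * s - card u" "card u \<le> 2 * s"
        using that A card_mono[of A u] by (auto simp: card_Diff_subset finite_subset)
      then show ?thesis by linarith
    qed
    then show ?thesis by (intro arg_cong[of _ _ card]) auto
  qed
  also have "\<dots> = card {u \<in> Pow A. (card u + k \<le> s) \<noteq> g' u}"
    by (rule card_Collect_involution[where \<phi> = "\<lambda>u. A - u"]) (auto simp: double_diff)
  finally have m2: "card {u \<in> Pow A. \<bar>?Y u\<bar> + ?K \<le> ?X u} \<le> card {u \<in> Pow A. (card u + k \<le> s) \<noteq> g' u}" .
  \<comment> \<open>Complementation exchanges the points with negative and with positive imbalance
    on \<open>N\<close>.\<close>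
  have half: "card {u \<in> Pow A. \<bar>imbalance P u\<bar> + ?K \<le> \<bar>imbalance N u\<bar>} \<le> 2 * card {u \<in> Pow A. \<bar>imbalance P u\<bar> + ?K \<le> imbalance N u}"
    if "P \<subseteq> A" "N \<subseteq> A" for P N
  proof -
    have fin: "finite P" "finite N" using that A finite_subset by auto
    have "card {u \<in> Pow A. \<bar>imbalance P u\<bar> + ?K \<le> \<bar>imbalance N u\<bar>} \<le>
      card ({u \<in> Pow A. \<bar>imbalance P u\<bar> + ?K \<le> imbalance N u} \<union> {u \<in> Pow A. \<bar>imbalance P (A - u)\<bar> + ?K \<le> imbalance N (A - u)})"
      using A that fin by (intro card_mono) (auto simp: imbalance_compl)
    also have "\<dots> \<le> card {u \<in> Pow A. \<bar>imbalance P u\<bar> + ?K \<le> imbalance N u} + card {u \<in> Pow A. \<bar>imbalance P (A - u)\<bar> + ?K \<le> imbalance N (A - u)}"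
      by (rule card_Un_le)
    also have "card {u \<in> Pow A. \<bar>imbalance P (A - u)\<bar> + ?K \<le> imbalance N (A - u)} = card {u \<in> Pow A. \<bar>imbalance P u\<bar> + ?K \<le> imbalance N u}"
      by (rule card_Collect_involution[where \<phi> = "\<lambda>u. A - u"]) (auto simp: double_diff)
    finally show ?thesis by simp
  qed
  have band: "middle_band s k A = {u \<in> Pow A. \<bar>?X u + ?Y u\<bar> < ?K}"
    unfolding middle_band_def by (auto simp: sum)
  \<comment> \<open>Reversing only the coordinates in \<open>N\<close> turns X - Y into X +
    Y.\<close>
  have "card {u \<in> Pow A. \<bar>?X u - ?Y u\<bar> < ?K} = card {u \<in> Pow A. \<bar>?X ((u \<inter> P) \<union> (N - u)) - ?Y ((u \<inter> P) \<union> (N - u))\<bar> < ?K}"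
    by (rule card_Collect_involution[where \<phi> = "\<lambda>u. (u \<inter> P) \<union> (N - u)", symmetric]) (use PN in auto)
  also have "\<dots> = card (middle_band s k A)"
  proof -
    have "?X ((u \<inter> P) \<union> (N - u)) = ?X u" "?Y ((u \<inter> P) \<union> (N - u)) = - ?Y u" for u
    proof -
      have "((u \<inter> P) \<union> (N - u)) \<inter> P = u \<inter> P" "((u \<inter> P) \<union> (N - u)) \<inter> N = (N - u) \<inter> N" using PN by auto
      then show "?X ((u \<inter> P) \<union> (N - u)) = ?X u" "?Y ((u \<inter> P) \<union> (N - u)) = - ?Y u"
        using imbalance_compl[of N N u] PN by (simp_all add: imbalance_def)
    qed
    then show ?thesis by (simp add: band)
  qed
  finally have band': "card {u \<in> Pow A. \<bar>?X u - ?Y u\<bar> < ?K} = card (middle_band s k A)" .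
  have "2 ^ (2 * s) = card (Pow A)" using A by (simp add: card_Pow)
  \<comment> \<open>Off the first two sets |X| and |Y| differ by less than 2k, and their difference
    is, up to sign, X - Y or X + Y.\<close>
  also have "\<dots> \<le> card (({u \<in> Pow A. \<bar>?X u\<bar> + ?K \<le> \<bar>?Y u\<bar>} \<union> {u \<in> Pow A. \<bar>?Y u\<bar> + ?K \<le> \<bar>?X u\<bar>})
      \<union> (middle_band s k A \<union> {u \<in> Pow A. \<bar>?X u - ?Y u\<bar> < ?K}))"
  proof (rule card_mono)
    show "Pow A \<subseteq> ({u \<in> Pow A. \<bar>?X u\<bar> + ?K \<le> \<bar>?Y u\<bar>} \<union> {u \<in> Pow A. \<bar>?Y u\<bar> + ?K \<le> \<bar>?X u\<bar>})
      \<union> (middle_band s k A \<union> {u \<in> Pow A. \<bar>?X u - ?Y u\<bar> < ?K})"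
      unfolding band by (rule subsetI) (simp, linarith)
  qed (use A in \<open>simp add: middle_band_def\<close>)
  also have "\<dots> \<le> card {u \<in> Pow A. \<bar>?X u\<bar> + ?K \<le> \<bar>?Y u\<bar>} + card {u \<in> Pow A. \<bar>?Y u\<bar> + ?K \<le> \<bar>?X u\<bar>}
      + (card (middle_band s k A) + card {u \<in> Pow A. \<bar>?X u - ?Y u\<bar> < ?K})"
    by (intro card_Un_le[THEN order_trans] add_mono card_Un_le)
  finally have total: "2 ^ (2 * s) \<le> card {u \<in> Pow A. \<bar>?X u\<bar> + ?K \<le> \<bar>?Y u\<bar>} + card {u \<in> Pow A. \<bar>?Y u\<bar> + ?K \<le> \<bar>?X u\<bar>}
      + (card (middle_band s k A) + card (middle_band s k A))" unfolding band' .
  have arith: "T \<le> 2 * (x + y) + 2 * c" if "T \<le> a + b + (c + c)" "p \<le> x" "q \<le> y" "a \<le> 2 * p" "b \<le> 2 * q"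
    for T a b c p q x y :: nat using that by simp
  show ?thesis
    by (rule arith[OF total m1 m2 half[OF PN(7) N] half[OF N PN(7)]])
qed

section \<open>Hard instances from control identifiers\<close>

text \<open>Isolates what the distance bounds need from Talagrand's DNF: moving up among the control
  variables, an identifier persists until \<open>high\<close> sets the function to 1. The functions
  live on \<open>p + 2\<close> coordinates, the last two being the switch.\<close>

locale hard_instance =
  fixes p :: nat and A :: "nat set" and s k :: nat
    and high :: "nat set \<Rightarrow> bool" and ctrl :: "nat set \<Rightarrow> nat option"
  assumes A: "A \<subseteq> {..<p}" "card A = 2 * s" and k: "k \<ge> 1"
    and high_mono: "\<lbrakk>y \<subseteq> y'; y' \<subseteq> {..<p} - A; high y\<rbrakk> \<Longrightarrow> high y'"
    and ctrl_mono: "\<lbrakk>y \<subseteq> y'; y' \<subseteq> {..<p} - A; ctrl y = Some i\<rbrakk> \<Longrightarrow> high y' \<or> ctrl y' = Some i"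
    and high_ctrl: "high y \<Longrightarrow> ctrl y = None"
begin

definition C :: "nat set" where "C = {..<p} - A"

definition ids :: "nat set set" where "ids = {y \<in> Pow C. ctrl y \<noteq> None}"

text \<open>\<open>e\<close> selects the close (\<open>True\<close>) or far (\<open>False\<close>) family, \<open>b\<close> is the set of identifiers with secret bit 1.\<close>
definition act :: "bool \<Rightarrow> bool \<Rightarrow> nat set \<Rightarrow> bool" where
  "act e \<beta> u = (if s + k \<le> card u then \<beta> else card u + k \<le> s \<and> \<beta> = e)"

text \<open>In the presence of an identifier, equal switch coordinates force 0 at 00 and 1 at 11.
  The settings 01 and 10 are incomparable, so they may show opposite bits without violating
  monotonicity.\<close>

definition hard :: "bool \<Rightarrow> nat set \<Rightarrow> nat set \<Rightarrow> bool" where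
  "hard e b x \<longleftrightarrow> high (x \<inter> C) \<or> (\<exists>i. ctrl (x \<inter> C) = Some i \<and>
     (if p \<in> x \<longleftrightarrow> p + 1 \<in> x then p \<in> x else act e ((i \<in> b) = (p \<in> x)) (x \<inter> A)))"

text \<open>The monotone function close to \<open>hard True b\<close>: \<open>act\<close> is
  replaced by the constant that it equals off the middle band.\<close>

definition smooth :: "nat set \<Rightarrow> nat set \<Rightarrow> bool" where
  "smooth b x \<longleftrightarrow> high (x \<inter> C) \<or> (\<exists>i. ctrl (x \<inter> C) = Some i \<and>
     (if p \<in> x \<longleftrightarrow> p + 1 \<in> x then p \<in> x else (i \<in> b) = (p \<in> x)))"

text \<open>The coordinates \<open>p\<close> and \<open>p + 1\<close> show each identifier with its secret bit and with the negated one
  equally often. So half of the identifiers' mass always sees either bit, without a concentration bound on \<open>b\<close>.\<close>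
definition switch :: "bool \<Rightarrow> nat set" where "switch \<beta> = (if \<beta> then {p} else {p + 1})"

lemma finite_A: "finite A" and finite_ids: "finite ids"
  using A by (auto simp: C_def ids_def intro: finite_subset)

text \<open>Going up either reaches \<open>high\<close> or keeps the identifier. With the identifier
  kept only the switch matters, and its values increase from 00 to 11.\<close>

lemma monotone_smooth: "monotone_bf (p + 2) (smooth b)"
  unfolding monotone_bf_def
proof (intro ballI impI)
  fix x y :: "nat set" assume xy: "x \<subseteq> y"
  have C: "x \<inter> C \<subseteq> y \<inter> C" "y \<inter> C \<subseteq> {..<p} - A" using xy by (auto simp: C_def)
  show "smooth b x \<le> smooth b y"
  proof (cases "high (y \<inter> C)")
    case False
    then have "\<not> high (x \<inter> C)" using high_mono[OF C] by blast
    moreover have "ctrl (x \<inter> C) = Some i \<Longrightarrow> ctrl (y \<inter> C) = Some i" for i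
      using ctrl_mono[OF C] False by blast
    ultimately show ?thesis using xy by (auto simp: smooth_def split: if_splits)
  qed (simp add: smooth_def)
qed

text \<open>On the middle band \<open>act\<close> is 0, so a disagreement requires the shown bit to
  be 1. This determines the switch setting, and each pair of control part and action part is counted
  once.\<close>

lemma bdist_hard_True_smooth:
  "bdist (p + 2) (hard True b) (smooth b) \<le> card ids * card (middle_band s k A) / 2 ^ (p + 2)"
proof -
  define emb where "emb = (\<lambda>(y, u). y \<union> u \<union> switch (the (ctrl y) \<in> b))"
  have "{x \<in> cube (p + 2). hard True b x \<noteq> smooth b x} \<subseteq> emb ` (ids \<times> middle_band s k A)"
  proof
    fix x assume x: "x \<in> {x \<in> cube (p + 2). hard True b x \<noteq> smooth b x}"
    then obtain i where i: "ctrl (x \<inter> C) = Some i" "p \<in> x \<longleftrightarrow> p + 1 \<notin> x"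
      "act True ((i \<in> b) = (p \<in> x)) (x \<inter> A) \<noteq> ((i \<in> b) = (p \<in> x))"
      by (auto simp: hard_def smooth_def split: if_splits)
    then have "x \<inter> A \<in> middle_band s k A" "(i \<in> b) = (p \<in> x)"
      by (auto simp: act_def middle_band_def split: if_splits)
    moreover have "x \<inter> C \<in> ids" using i by (simp add: ids_def)
    moreover have "x = emb (x \<inter> C, x \<inter> A)"
    proof -
      have "j \<in> x \<longleftrightarrow> j \<in> emb (x \<inter> C, x \<inter> A)" for j
      proof -
        consider "j < p" | "j = p" | "j = p + 1" | "j \<ge> p + 2" by linarith
        then show ?thesis
          using x i \<open>(i \<in> b) = (p \<in> x)\<close> A
          by cases (auto simp: emb_def switch_def C_def cube_def)
      qed
      then show ?thesis by blast
    qed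
    ultimately show "x \<in> emb ` (ids \<times> middle_band s k A)" by blast
  qed
  then have "card {x \<in> cube (p + 2). hard True b x \<noteq> smooth b x} \<le> card (emb ` (ids \<times> middle_band s k A))"
    using finite_ids finite_A by (intro card_mono) (auto simp: middle_band_def)
  also have "\<dots> \<le> card ids * card (middle_band s k A)"
    unfolding card_cartesian_product[symmetric]
    using finite_ids finite_A by (intro card_image_le) (simp add: middle_band_def)
  finally show ?thesis
    unfolding bdist_def by (intro divide_right_mono) (simp_all flip: of_nat_mult)
qed

section \<open>Distance of the far family from unate functions\<close>

lemma hard_ctrl:
  assumes "ctrl (x \<inter> C) = Some i" "(p \<in> x) \<noteq> (p + 1 \<in> x)"
  shows "hard e b x = act e ((i \<in> b) = (p \<in> x)) (x \<inter> A)"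
proof -
  have "\<not> high (x \<inter> C)" using high_ctrl[of "x \<inter> C"] assms(1) by auto
  moreover have "\<not> (p \<in> x \<longleftrightarrow> p + 1 \<in> x)" using assms(2) by auto
  ultimately show ?thesis by (simp only: hard_def assms(1) if_False) simp
qed

lemma hard_embedding:
  assumes "y \<in> Pow C" "u \<in> Pow A" "ctrl y = Some i"
  shows "hard e b (y \<union> u \<union> switch (\<beta> = (i \<in> b))) \<longleftrightarrow> act e \<beta> u"
proof -
  let ?x = "y \<union> u \<union> switch (\<beta> = (i \<in> b))"
  have *: "?x \<inter> C = y" "?x \<inter> A = u" "p \<in> ?x \<longleftrightarrow> \<beta> = (i \<in> b)" "p + 1 \<in> ?x \<longleftrightarrow> \<beta> \<noteq> (i \<in> b)"
    using assms A by (auto simp: C_def switch_def)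
  have "hard e b ?x = act e ((i \<in> b) = (p \<in> ?x)) (?x \<inter> A)"
    by (rule hard_ctrl) (unfold *, use assms(3) in auto)
  moreover have "((i \<in> b) = (p \<in> ?x)) = \<beta>" unfolding *(3) by blast
  ultimately show ?thesis unfolding *(2) by simp
qed

text \<open>Above each control part with an identifier, the two unequal switch settings show a
  threshold and a reversed threshold of the action variables. The shift \<open>r\<close> of
  \<open>g\<close> serves both: \<open>g\<close> is antitone along \<open>r \<inter> A\<close> and
  monotone along the rest of \<open>A\<close>, so \<open>opposite_thresholds_mismatch\<close>
  applies to each control part and the counts add up.\<close>

lemma hard_False_mismatch:
  assumes g: "unate_bf (p + 2) g"
  shows "2 ^ (2 * s) * card ids \<le>
    2 * card {x \<in> cube (p + 2). hard False b x \<noteq> g x} + 2 * card ids * card (middle_band s k A)"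
proof -
  obtain r where r: "monotone_bf (p + 2) (\<lambda>x. g ((x - r) \<union> (r - x)))" and r_cube: "r \<in> cube (p + 2)"
    using g by (auto simp: unate_bf_def)
  define emb where "emb \<beta> y u = y \<union> u \<union> switch (\<beta> = (the (ctrl y) \<in> b))" for \<beta> y u
  define bad where "bad y \<beta> = {u \<in> Pow A. act False \<beta> u \<noteq> g (emb \<beta> y u)}" for y \<beta>
  have emb_cube: "emb \<beta> y u \<in> cube (p + 2)" if "y \<in> ids" "u \<subseteq> A" for \<beta> y u
    using that A by (force simp: emb_def switch_def ids_def C_def cube_def)
  \<comment> \<open>Adding coordinates outside \<open>r\<close> and removing coordinates of
    \<open>r\<close> both move upwards after the shift by \<open>r\<close>.\<close>
  have g_mono: "g x"
    if "x \<in> cube (p + 2)" "x' \<in> cube (p + 2)" "x - x' \<subseteq> - r" "x' - x \<subseteq> r" "g x'" for x x'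
  proof -
    have 1: "(x - r) \<union> (r - x) \<in> cube (p + 2)" "(x' - r) \<union> (r - x') \<in> cube (p + 2)"
      using that r_cube by (auto simp: cube_def)
    have 2: "(x' - r) \<union> (r - x') \<subseteq> (x - r) \<union> (r - x)"
      using that by auto
    have "(((x - r) \<union> (r - x)) - r) \<union> (r - ((x - r) \<union> (r - x))) = x"
      "(((x' - r) \<union> (r - x')) - r) \<union> (r - ((x' - r) \<union> (r - x'))) = x'" by auto
    then show "g x"
      using r 1 2 that(5) unfolding monotone_bf_def by (metis le_bool_def)
  qed
  have each: "2 ^ (2 * s) \<le> 2 * (card (bad y True) + card (bad y False)) + 2 * card (middle_band s k A)"
    if y: "y \<in> ids" for y
  proof -
    have diff: "emb \<beta> y u - emb \<beta> y u' \<subseteq> u - u'" for \<beta> u u'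
      by (auto simp: emb_def)
    have "2 ^ (2 * s) \<le> 2 * (card {u \<in> Pow A. (s + k \<le> card u) \<noteq> g (emb True y u)}
        + card {u \<in> Pow A. (card u + k \<le> s) \<noteq> g (emb False y u)}) + 2 * card (middle_band s k A)"
    proof (rule opposite_thresholds_mismatch[OF finite_A A(2) _ k, where N = "r \<inter> A"])
      fix u u' assume u: "u \<subseteq> u'" "u' \<subseteq> A" "u' - u \<subseteq> r \<inter> A" "g (emb True y u')"
      show "g (emb True y u)"
        by (rule g_mono[OF emb_cube[OF y] emb_cube[OF y] _ _ u(4)])
           (use u diff[of True u u'] diff[of True u' u] in auto)
    next
      fix u u' assume u: "u \<subseteq> u'" "u' \<subseteq> A" "u' - u \<subseteq> A - r \<inter> A" "g (emb False y u)"
      show "g (emb False y u')"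
        by (rule g_mono[OF emb_cube[OF y] emb_cube[OF y] _ _ u(4)])
           (use u diff[of False u u'] diff[of False u' u] in auto)
    qed simp
    moreover have "bad y True = {u \<in> Pow A. (s + k \<le> card u) \<noteq> g (emb True y u)}"
      by (auto simp: bad_def act_def)
    moreover have "bad y False = {u \<in> Pow A. (card u + k \<le> s) \<noteq> g (emb False y u)}"
      using k by (auto simp: bad_def act_def)
    ultimately show ?thesis by simp
  qed
  let ?S = "SIGMA (y, \<beta>) : ids \<times> UNIV. bad y \<beta>"
  have fin_bad: "finite (bad y \<beta>)" for y \<beta>
    using finite_A by (simp add: bad_def)
  \<comment> \<open>Control part, shown bit and action part can be read off the embedded point, so
    no mismatch is counted twice.\<close>
  have inj: "inj_on (\<lambda>((y, \<beta>), u). emb \<beta> y u) ?S"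
  proof -
    have *: "emb \<beta> y u \<inter> C = y" "emb \<beta> y u \<inter> A = u" "p \<in> emb \<beta> y u \<longleftrightarrow> \<beta> = (the (ctrl y) \<in> b)"
      if "y \<in> ids" "u \<in> bad y \<beta>" for y u \<beta>
      using that A by (auto simp: emb_def ids_def bad_def C_def switch_def)
    show ?thesis
      by (rule inj_on_inverseI[where g = "\<lambda>x. ((x \<inter> C, (p \<in> x) = (the (ctrl (x \<inter> C)) \<in> b)), x \<inter> A)"])
         (clarsimp simp: *, blast)
  qed
  have "(\<Sum>y\<in>ids. card (bad y True) + card (bad y False)) = (\<Sum>(y, \<beta>)\<in>ids \<times> UNIV. card (bad y \<beta>))"
    by (simp add: sum.cartesian_product[symmetric] UNIV_bool add.commute)
  also have "\<dots> = card ?S"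
    using finite_ids fin_bad by (subst card_SigmaI) (auto simp: case_prod_beta)
  also have "\<dots> = card ((\<lambda>((y, \<beta>), u). emb \<beta> y u) ` ?S)"
    using inj by (rule card_image[symmetric])
  also have "\<dots> \<le> card {x \<in> cube (p + 2). hard False b x \<noteq> g x}"
  proof (rule card_mono)
    show "(\<lambda>((y, \<beta>), u). emb \<beta> y u) ` ?S \<subseteq> {x \<in> cube (p + 2). hard False b x \<noteq> g x}"
    proof clarify
      fix y \<beta> u assume y: "y \<in> ids" and u: "u \<in> bad y \<beta>"
      then obtain i where "ctrl y = Some i" "y \<in> Pow C" by (auto simp: ids_def)
      then have "hard False b (emb \<beta> y u) \<longleftrightarrow> act False \<beta> u"
        unfolding emb_def using u by (subst hard_embedding) (auto simp: bad_def)
      then show "emb \<beta> y u \<in> cube (p + 2) \<and> hard False b (emb \<beta> y u) \<noteq> g (emb \<beta> y u)"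
        using emb_cube[OF y] u by (auto simp: bad_def)
    qed
  qed (simp add: cube_def)
  finally have mism: "(\<Sum>y\<in>ids. card (bad y True) + card (bad y False)) \<le> card {x \<in> cube (p + 2). hard False b x \<noteq> g x}" .
  have "2 ^ (2 * s) * card ids = (\<Sum>y\<in>ids. 2 ^ (2 * s))" by simp
  also have "\<dots> \<le> (\<Sum>y\<in>ids. 2 * (card (bad y True) + card (bad y False)) + 2 * card (middle_band s k A))"
    by (rule sum_mono) (rule each)
  also have "\<dots> = 2 * (\<Sum>y\<in>ids. card (bad y True) + card (bad y False)) + 2 * card ids * card (middle_band s k A)"
    unfolding sum.distrib by (simp add: sum_distrib_left sum.distrib mult_ac)
  finally show ?thesis using mism by linarith
qed

lemma bdist_hard_False:
  assumes "unate_bf (p + 2) g"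
  shows "card ids * (2 ^ (2 * s) / 2 - card (middle_band s k A)) / 2 ^ (p + 2) \<le> bdist (p + 2) (hard False b) g"
proof -
  have "real (2 ^ (2 * s) * card ids) \<le>
    real (2 * card {x \<in> cube (p + 2). hard False b x \<noteq> g x} + 2 * card ids * card (middle_band s k A))"
    using hard_False_mismatch[OF assms, of b] by (rule of_nat_mono)
  then have "real (card ids) * (2 ^ (2 * s) / 2 - card (middle_band s k A)) \<le> card {x \<in> cube (p + 2). hard False b x \<noteq> g x}"
    by (simp add: algebra_simps)
  then show ?thesis unfolding bdist_def by (intro divide_right_mono) auto
qed

section \<open>Pairs of queries that can tell the two families apart\<close>

definition separates :: "nat set \<Rightarrow> nat set \<Rightarrow> bool" where
  "separates x y \<longleftrightarrow> ctrl (x \<inter> C) \<noteq> None \<and> ctrl (x \<inter> C) = ctrl (y \<inter> C) \<and>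
     card (x \<inter> A) + k \<le> s \<and> s + k \<le> card (y \<inter> A)"

text \<open>\<open>F\<close> collects the identifiers queried on a low action layer. None of them is queried on a high
  one, so flipping their secret bits turns one family into the other on \<open>X\<close>.\<close>
lemma hard_flip:
  assumes "\<And>x y. x \<in> X \<Longrightarrow> y \<in> X \<Longrightarrow> \<not> separates x y" and "x \<in> X"
    and F: "F = {i. \<exists>x\<in>X. ctrl (x \<inter> C) = Some i \<and> card (x \<inter> A) + k \<le> s}"
  shows "hard False b x = hard True ((b - F) \<union> (F - b)) x"
proof (cases "ctrl (x \<inter> C) = None \<or> (p \<in> x \<longleftrightarrow> p + 1 \<in> x)")
  case True
  then show ?thesis by (auto simp: hard_def)
next
  case False
  then obtain i where i: "ctrl (x \<inter> C) = Some i" and p: "(p \<in> x) \<noteq> (p + 1 \<in> x)" by auto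
  have "act False ((i \<in> b) = (p \<in> x)) (x \<inter> A) = act True ((i \<in> (b - F) \<union> (F - b)) = (p \<in> x)) (x \<inter> A)"
  proof (cases "s + k \<le> card (x \<inter> A)")
    case True
    then have "i \<notin> F" using assms(1)[OF _ \<open>x \<in> X\<close>] i unfolding F separates_def by auto
    then show ?thesis using True by (simp add: act_def)
  next
    case False
    then show ?thesis using i \<open>x \<in> X\<close> by (auto simp: act_def F)
  qed
  then show ?thesis by (simp only: hard_ctrl[OF i p])
qed

end

section \<open>Random DNFs\<close>

text \<open>\<open>\<tau> i j\<close> is the \<open>j\<close>-th variable of the \<open>i\<close>-th
  conjunction.\<close>

definition sat :: "nat \<Rightarrow> nat \<Rightarrow> (nat \<Rightarrow> nat \<Rightarrow> nat) \<Rightarrow> nat set \<Rightarrow> nat set" where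
  "sat N w \<tau> y = {i \<in> {..<N}. \<forall>j<w. \<tau> i j \<in> y}"

text \<open>Talagrand's multiplexer on the \<open>l\<close> layers ending at layer \<open>m\<close>:
  no satisfied term gives 0, a single one is the identifier, several give 1. Points above these
  layers get 1 and points below them 0.\<close>

definition talagrand_high :: "nat \<Rightarrow> nat \<Rightarrow> (nat set \<Rightarrow> nat set) \<Rightarrow> nat set \<Rightarrow> bool" where
  "talagrand_high m l S y \<longleftrightarrow> m < card y \<or> (m < card y + l \<and> (\<exists>i\<in>S y. \<exists>j\<in>S y. i \<noteq> j))"

definition talagrand_ctrl :: "nat \<Rightarrow> nat \<Rightarrow> (nat set \<Rightarrow> nat set) \<Rightarrow> nat set \<Rightarrow> nat option" where
  "talagrand_ctrl m l S y = (if m < card y + l \<and> card y \<le> m \<and> is_singleton (S y) then Some (the_elem (S y)) else None)"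

lemma sat_mono: "y \<subseteq> y' \<Longrightarrow> sat N w \<tau> y \<subseteq> sat N w \<tau> y'"
  by (auto simp: sat_def)

lemma talagrand_ctrl_eq_Some: "talagrand_ctrl m l S y = Some i \<longleftrightarrow> m < card y + l \<and> card y \<le> m \<and> S y = {i}"
proof -
  have "is_singleton (S y) \<and> the_elem (S y) = i \<longleftrightarrow> S y = {i}"
    by (metis is_singletonI is_singleton_the_elem the_elem_eq)
  then show ?thesis by (auto simp: talagrand_ctrl_def)
qed

lemma talagrand_ctrl_neq_None: "talagrand_ctrl m l S y \<noteq> None \<longleftrightarrow> m < card y + l \<and> card y \<le> m \<and> is_singleton (S y)"
  by (auto simp: talagrand_ctrl_def)

text \<open>A larger point satisfies at least the same terms. So a unique satisfied term stays
  unique, or is joined by another, or the point leaves the layers upwards; the last two outcomes are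
  \<open>high\<close>.\<close>

lemma hard_instance_talagrand:
  assumes "A \<subseteq> {..<p}" "card A = 2 * s" "k \<ge> 1"
  shows "hard_instance p A s k (talagrand_high m l (sat N w \<tau>)) (talagrand_ctrl m l (sat N w \<tau>))"
proof
  fix y y' assume y: "y \<subseteq> y'" "y' \<subseteq> {..<p} - A"
  have card: "card y \<le> card y'" using y by (intro card_mono) (auto intro: finite_subset)
  show "talagrand_high m l (sat N w \<tau>) y'" if "talagrand_high m l (sat N w \<tau>) y"
  proof -
    have "m < card y \<Longrightarrow> m < card y'" "m < card y + l \<Longrightarrow> m < card y' + l" using card by linarith+
    then show ?thesis using that sat_mono[OF y(1), of N w \<tau>] unfolding talagrand_high_def by blast
  qed
  show "talagrand_high m l (sat N w \<tau>) y' \<or> talagrand_ctrl m l (sat N w \<tau>) y' = Some i"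
    if "talagrand_ctrl m l (sat N w \<tau>) y = Some i" for i
    using that card sat_mono[OF y(1), of N w \<tau>] by (auto simp: talagrand_ctrl_eq_Some talagrand_high_def)
next
  fix y assume "talagrand_high m l (sat N w \<tau>) y"
  then show "talagrand_ctrl m l (sat N w \<tau>) y = None"
    by (auto simp: talagrand_high_def talagrand_ctrl_def is_singleton_def)
qed (use assms in auto)

text \<open>Sequences with repetition instead of \<open>w\<close>-element sets: the variables are
  then independent, and a fixed \<open>y \<subseteq> C\<close> satisfies exactly
  \<open>card y ^ w\<close> of the \<open>card C ^ w\<close> terms.\<close>

definition terms :: "nat \<Rightarrow> 'a set \<Rightarrow> (nat \<Rightarrow> 'a) set" where
  "terms w C = ({..<w} \<rightarrow>\<^sub>E C)"

definition formulas :: "nat \<Rightarrow> nat \<Rightarrow> nat set \<Rightarrow> (nat \<Rightarrow> nat \<Rightarrow> nat) set" where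
  "formulas N w C = ({..<N} \<rightarrow>\<^sub>E terms w C)"

lemma finite_terms: "finite C \<Longrightarrow> finite (terms w C)" and card_terms: "card (terms w C) = card C ^ w"
  by (auto simp: terms_def card_PiE intro: finite_PiE)

lemma finite_formulas: "finite C \<Longrightarrow> finite (formulas N w C)"
  and card_formulas: "card (formulas N w C) = (card C ^ w) ^ N"
  by (auto simp: formulas_def card_PiE card_terms finite_terms intro!: finite_PiE)

section \<open>Counting formulas by the terms that given points satisfy\<close>

lemma card_PiE_distinguished:
  assumes "i < N"
  shows "card (PiE {..<N} (\<lambda>j. if j = i then S else T)) = card S * card T ^ (N - 1)"
proof -
  have "(\<Prod>j<N. card (if j = i then S else T)) = card S * (\<Prod>j\<in>{..<N} - {i}. card (if j = i then S else T))"
    using assms by (subst prod.remove[of _ i]) auto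
  also have "(\<Prod>j\<in>{..<N} - {i}. card (if j = i then S else T)) = (\<Prod>j\<in>{..<N} - {i}. card T)"
    by (rule prod.cong) auto
  finally show ?thesis using assms by (simp add: card_PiE)
qed

lemma in_sat_iff:
  assumes "\<tau> \<in> formulas N w C"
  shows "i \<in> sat N w \<tau> y \<longleftrightarrow> i < N \<and> \<tau> i \<in> terms w (y \<inter> C)"
proof -
  have "\<tau> i \<in> terms w C" if "i < N" using assms that by (auto simp: formulas_def)
  then show ?thesis by (auto simp: sat_def terms_def PiE_iff)
qed

text \<open>For each index \<open>i\<close>, the formulas in which \<open>y\<close> satisfies term
  \<open>i\<close> and no other form a product set, and these sets are disjoint.\<close>

lemma card_unique_formulas:
  assumes C: "finite C" and y: "y \<subseteq> C"
  shows "N * (card y ^ w * (card C ^ w - card y ^ w) ^ (N - 1)) \<le> card {\<tau> \<in> formulas N w C. is_singleton (sat N w \<tau> y)}"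
proof -
  define F where "F i = PiE {..<N} (\<lambda>j. if j = i then terms w y else terms w C - terms w y)" for i
  have fin: "finite (terms w y)" "finite (terms w C)" using assms finite_subset finite_terms by metis+
  have sub: "terms w y \<subseteq> terms w C" using y by (auto simp: terms_def)
  have F_formulas: "F i \<subseteq> formulas N w C" for i
    unfolding F_def formulas_def using sub by (intro PiE_mono) auto
  have sat_F: "sat N w \<tau> y = {i}" if "i < N" "\<tau> \<in> F i" for i \<tau>
  proof -
    have "\<tau> \<in> formulas N w C" using that F_formulas by auto
    moreover have "y \<inter> C = y" using y by auto
    moreover have "j < N \<Longrightarrow> \<tau> j \<in> terms w y \<longleftrightarrow> j = i" for j
      using that(2) PiE_mem[of \<tau> "{..<N}" _ j] by (fastforce simp: F_def split: if_splits)
    ultimately show ?thesis using that(1) by (auto simp: in_sat_iff)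
  qed
  have "(\<Sum>i<N. card (F i)) = N * (card y ^ w * (card C ^ w - card y ^ w) ^ (N - 1))"
    using fin sub by (simp add: F_def card_PiE_distinguished card_Diff_subset card_terms)
  moreover have "(\<Sum>i<N. card (F i)) = card (\<Union>i<N. F i)"
  proof (rule card_UN_disjoint[symmetric])
    show "\<forall>i\<in>{..<N}. finite (F i)"
      using F_formulas finite_formulas[OF C] finite_subset by blast
    show "\<forall>i\<in>{..<N}. \<forall>j\<in>{..<N}. i \<noteq> j \<longrightarrow> F i \<inter> F j = {}"
      using sat_F by blast
  qed simp
  moreover have "card (\<Union>i<N. F i) \<le> card {\<tau> \<in> formulas N w C. is_singleton (sat N w \<tau> y)}"
    using F_formulas sat_F by (intro card_mono) (auto simp: finite_formulas C is_singleton_def)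
  ultimately show ?thesis by simp
qed

text \<open>Union bound over the index of a common term, all of whose variables must lie in both
  points.\<close>

lemma card_common_formulas:
  assumes C: "finite C" and N: "N \<ge> 1"
  shows "card {\<tau> \<in> formulas N w C. sat N w \<tau> y \<inter> sat N w \<tau> y' \<noteq> {}}
    \<le> N * (card (y \<inter> y' \<inter> C) ^ w * (card C ^ w) ^ (N - 1))"
proof -
  define F where "F i = PiE {..<N} (\<lambda>j. if j = i then terms w (y \<inter> y' \<inter> C) else terms w C)" for i
  have "{\<tau> \<in> formulas N w C. sat N w \<tau> y \<inter> sat N w \<tau> y' \<noteq> {}} \<subseteq> (\<Union>i<N. F i)"
  proof
    fix \<tau> assume "\<tau> \<in> {\<tau> \<in> formulas N w C. sat N w \<tau> y \<inter> sat N w \<tau> y' \<noteq> {}}"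
    then obtain i where \<tau>: "\<tau> \<in> formulas N w C" and i: "i \<in> sat N w \<tau> y" "i \<in> sat N w \<tau> y'" by auto
    then have "i < N" "\<tau> i \<in> terms w (y \<inter> y' \<inter> C)"
      unfolding in_sat_iff[OF \<tau>] by (auto simp: terms_def PiE_iff)
    then show "\<tau> \<in> (\<Union>i<N. F i)"
      using \<tau> by (auto simp: F_def formulas_def PiE_iff)
  qed
  moreover have "finite (F i)" for i
    unfolding F_def using C by (intro finite_PiE) (auto intro: finite_terms)
  ultimately have "card {\<tau> \<in> formulas N w C. sat N w \<tau> y \<inter> sat N w \<tau> y' \<noteq> {}} \<le> card (\<Union>i<N. F i)"
    by (intro card_mono) auto
  also have "\<dots> \<le> (\<Sum>i<N. card (F i))" by (rule card_UN_le) simp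
  also have "\<dots> = N * (card (y \<inter> y' \<inter> C) ^ w * (card C ^ w) ^ (N - 1))"
    by (simp add: F_def card_PiE_distinguished card_terms)
  finally show ?thesis .
qed

definition mid_layers :: "nat \<Rightarrow> nat set \<Rightarrow> nat set set" where
  "mid_layers l C = {y \<in> Pow C. card C div 2 < card y + l \<and> card y \<le> card C div 2}"

text \<open>A term is satisfied with probability \<open>\<theta> = (r / c) ^ w\<close>, and
  \<open>N = 2 ^ (w - 1)\<close> makes the expected number of satisfied terms (2r/c)^w / 2. This
  lies between 1/4 and 1/2: above because 2r \<le> c, below by Bernoulli's inequality because 2lw
  \<le> c/2. A second use of Bernoulli's inequality bounds the chance that all other terms fail by
  1/2 from below, so the product is at least 1/8.\<close>

lemma unique_formulas_fraction:
  assumes C: "finite C" and y: "y \<in> mid_layers l C" and w: "w \<ge> 1" "4 * l * w \<le> card C" and l: "l \<ge> 1"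
  shows "real (card (formulas (2 ^ (w - 1)) w C)) / 8 \<le>
    card {\<tau> \<in> formulas (2 ^ (w - 1)) w C. is_singleton (sat (2 ^ (w - 1)) w \<tau> y)}"
proof -
  define c r N where "c = card C" "r = card y" "N = (2::nat) ^ (w - 1)"
  define \<theta> where "\<theta> = (real r / c) ^ w"
  have yC: "y \<subseteq> C" and r: "c div 2 < r + l" "r \<le> c div 2"
    using y by (auto simp: mid_layers_def c_r_N_def)
  have "1 * 1 \<le> l * w" using w l by (intro mult_le_mono) auto
  then have c: "c \<ge> 4" using w(2) unfolding c_r_N_def mult.assoc by linarith
  have N: "N \<ge> 1" "real N = 2 ^ w / 2" using w by (cases w; simp add: c_r_N_def)+
  have N\<theta>: "N * \<theta> = (2 * real r / c) ^ w / 2"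
    by (simp add: \<theta>_def N power_mult_distrib power_divide)
  have "(2 * real r / c) ^ w \<le> 1 ^ w"
    using r c by (intro power_mono) (auto simp: field_simps)
  then have up: "N * \<theta> \<le> 1 / 2" unfolding N\<theta> by simp
  have "c < 2 * r + 2 * l" using r by linarith
  then have "(real c - 2 * real l) / c \<le> 2 * real r / c" by (intro divide_right_mono) auto
  then have "1 - 2 * real l / c \<le> 2 * real r / c" using c by (simp add: diff_divide_distrib)
  moreover have lw: "4 * real l * w \<le> c"
    using w(2) unfolding c_r_N_def by (metis of_nat_le_iff of_nat_mult of_nat_numeral)
  have "2 * l * 1 \<le> 4 * l * w" using w by (intro mult_le_mono) auto
  then have "2 * l \<le> c" using w(2) unfolding c_r_N_def by linarith
  then have l1: "2 * real l / c \<le> 1" using c by (simp add: field_simps)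
  ultimately have "(1 - 2 * real l / c) ^ w \<le> (2 * real r / c) ^ w"
    by (intro power_mono) auto
  moreover have "1 + real w * (- (2 * real l / c)) \<le> (1 + - (2 * real l / c)) ^ w"
    by (rule Bernoulli_inequality) (use l1 in simp)
  moreover have "real w * (2 * real l / c) \<le> 1 / 2"
    using lw c by (simp add: field_simps)
  ultimately have lo: "1 / 4 \<le> N * \<theta>" unfolding N\<theta> by simp
  have \<theta>0: "\<theta> \<ge> 0" by (simp add: \<theta>_def)
  have "\<theta> \<le> N * \<theta>" using N(1) \<theta>0 by (simp add: mult_le_cancel_right1)
  then have \<theta>1: "\<theta> \<le> 1" using up by linarith
  have "1 / 2 \<le> 1 + real (N - 1) * (- \<theta>)"
  proof -
    have "real (N - 1) * \<theta> \<le> real N * \<theta>" using \<theta>0 by (intro mult_right_mono) auto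
    then show ?thesis using up by simp
  qed
  also have "\<dots> \<le> (1 + - \<theta>) ^ (N - 1)"
    by (rule Bernoulli_inequality) (use \<theta>1 in simp)
  finally have main: "1 / 4 * (1 / 2) \<le> (N * \<theta>) * (1 - \<theta>) ^ (N - 1)"
    using lo by (intro mult_mono) auto
  have e1: "real (c ^ w) * \<theta> = real (r ^ w)"
    using c by (simp add: \<theta>_def power_divide)
  have "r \<le> c" using r by linarith
  then have "real (c ^ w) * (1 - \<theta>) = real (c ^ w - r ^ w)"
    using e1 by (simp add: right_diff_distrib power_mono of_nat_diff)
  note e = e1 this
  have "real (c ^ w) ^ N * (1 / 8) \<le> real (c ^ w) ^ N * ((N * \<theta>) * (1 - \<theta>) ^ (N - 1))"
    using main by (intro mult_left_mono) auto
  also have pw: "real (c ^ w) ^ N = real (c ^ w) * real (c ^ w) ^ (N - 1)"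
    using N(1) by (cases N) auto
  also have "real (c ^ w) * real (c ^ w) ^ (N - 1) * ((N * \<theta>) * (1 - \<theta>) ^ (N - 1)) =
      N * ((real (c ^ w) * \<theta>) * (real (c ^ w) * (1 - \<theta>)) ^ (N - 1))"
    by (simp add: power_mult_distrib mult_ac)
  also have "\<dots> = real (N * (r ^ w * (c ^ w - r ^ w) ^ (N - 1)))"
    unfolding e by simp
  also have "\<dots> \<le> card {\<tau> \<in> formulas N w C. is_singleton (sat N w \<tau> y)}"
    using card_unique_formulas[OF C yC] unfolding c_r_N_def by (rule of_nat_mono)
  finally have "real (c ^ w) ^ N * (1 / 8) \<le> card {\<tau> \<in> formulas N w C. is_singleton (sat N w \<tau> y)}"
    unfolding pw .
  moreover have "real (c ^ w) ^ N = card (formulas N w C)"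
    by (simp add: card_formulas c_r_N_def)
  ultimately show ?thesis unfolding c_r_N_def by linarith
qed

text \<open>Both points fill at most half of \<open>C\<close>, so twice their intersection plus
  their symmetric difference is at most \<open>card C\<close>. Hence the union bound (2r/c)^w / 2,
  with r the size of the intersection, decays exponentially in the symmetric difference.\<close>

lemma common_formulas_fraction:
  assumes C: "finite C" and y: "y \<in> mid_layers l C" "y' \<in> mid_layers l C" and w: "w \<ge> 1" and c: "C \<noteq> {}"
  shows "card {\<tau> \<in> formulas (2 ^ (w - 1)) w C. sat (2 ^ (w - 1)) w \<tau> y \<inter> sat (2 ^ (w - 1)) w \<tau> y' \<noteq> {}}
    \<le> exp (- (w / card C) * card (sym_diff y y')) * card (formulas (2 ^ (w - 1)) w C)"
proof -
  define c r N where "c = card C" "r = card (y \<inter> y')" "N = (2::nat) ^ (w - 1)"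
  have N: "N \<ge> 1" "real N = 2 ^ w / 2" using w by (cases w; simp add: c_r_N_def)+
  have c0: "c > 0" using C c by (simp add: c_r_N_def card_gt_0_iff)
  have sub: "y \<subseteq> C" "y' \<subseteq> C" "y \<inter> y' \<inter> C = y \<inter> y'" and cards: "2 * card y \<le> c" "2 * card y' \<le> c"
    using y by (auto simp: mid_layers_def c_r_N_def)
  have fin: "finite y" "finite y'" using finite_subset[OF sub(1) C] finite_subset[OF sub(2) C] by auto
  have "card (sym_diff y y') = card (y - y') + card (y' - y)"
    using fin by (intro card_Un_disjoint) auto
  moreover have "card y = r + card (y - y')" "card y' = r + card (y' - y)"
    using fin card_Int_Diff[of y y'] card_Int_Diff[of y' y] by (auto simp: c_r_N_def Int_commute)
  ultimately have "2 * r + card (sym_diff y y') \<le> c" using cards by linarith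
  then have "2 * real r / c \<le> 1 + - (card (sym_diff y y') / c)"
    using c0 by (simp add: field_simps)
  also have "\<dots> \<le> exp (- (card (sym_diff y y') / c))" by (rule exp_ge_add_one_self)
  finally have "(2 * real r / c) ^ w \<le> exp (- (card (sym_diff y y') / c)) ^ w"
    by (intro power_mono) auto
  also have "\<dots> = exp (- (w / c) * card (sym_diff y y'))"
    by (simp flip: exp_of_nat_mult)
  finally have "(2 * real r / c) ^ w \<le> exp (- (w / c) * card (sym_diff y y'))" .
  moreover have "N * (real r / c) ^ w = (2 * real r / c) ^ w / 2"
    by (simp add: N power_mult_distrib power_divide)
  moreover have "(2 * real r / c) ^ w \<ge> 0" by simp
  ultimately have \<theta>: "N * (real r / c) ^ w \<le> exp (- (w / c) * card (sym_diff y y'))"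
    by linarith
  have "real (card {\<tau> \<in> formulas N w C. sat N w \<tau> y \<inter> sat N w \<tau> y' \<noteq> {}}) \<le> real (N * (r ^ w * (c ^ w) ^ (N - 1)))"
    using card_common_formulas[OF C N(1), of w y y'] sub by (intro of_nat_mono) (simp add: c_r_N_def)
  also have "\<dots> = (N * (real r / c) ^ w) * (real (c ^ w) * real (c ^ w) ^ (N - 1))"
    using c0 by (simp add: power_divide)
  also have "real (c ^ w) * real (c ^ w) ^ (N - 1) = real (c ^ w) ^ N"
    using N(1) by (cases N) auto
  also have "(N * (real r / c) ^ w) * real (c ^ w) ^ N \<le> exp (- (w / c) * card (sym_diff y y')) * real (c ^ w) ^ N"
    using \<theta> by (intro mult_right_mono) auto
  finally show ?thesis by (simp add: card_formulas c_r_N_def)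
qed

definition good_formulas :: "nat \<Rightarrow> nat \<Rightarrow> nat set \<Rightarrow> (nat \<Rightarrow> nat \<Rightarrow> nat) set" where
  "good_formulas l w C = {\<tau> \<in> formulas (2 ^ (w - 1)) w C. card (mid_layers l C) \<le>
     16 * card {y \<in> mid_layers l C. is_singleton (sat (2 ^ (w - 1)) w \<tau> y)}}"

text \<open>Reverse Markov inequality: the average fraction of middle points with an identifier is
  at least 1/8, so at least 1/16 of the formulas reach the fraction 1/16.\<close>

lemma card_good_formulas:
  assumes C: "finite C" and w: "w \<ge> 1" "4 * l * w \<le> card C" and l: "l \<ge> 1"
  shows "card (formulas (2 ^ (w - 1)) w C) \<le> 16 * card (good_formulas l w C)"
proof -
  define N where "N = (2::nat) ^ (w - 1)"
  define F M D where "F = formulas N w C" "M = mid_layers l C"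
    "D = (\<lambda>\<tau>. card {y \<in> mid_layers l C. is_singleton (sat N w \<tau> y)})"
  have fin: "finite F" "finite M" using C by (auto simp: F_M_D_def finite_formulas mid_layers_def)
  have good: "good_formulas l w C = {\<tau> \<in> F. card M \<le> 16 * D \<tau>}"
    by (simp add: good_formulas_def F_M_D_def N_def)
  have "card M > 0"
  proof -
    obtain y where "y \<subseteq> C" "card y = card C div 2"
      by (meson obtain_subset_with_card_n div_le_dividend)
    then have "y \<in> M" using l by (auto simp: F_M_D_def mid_layers_def)
    then show ?thesis using fin by (auto simp: card_gt_0_iff)
  qed
  have cnt: "card {x \<in> X. Q x} = (\<Sum>x\<in>X. of_bool (Q x))" if "finite X" for X :: "nat set set" and Q
    using that by (simp add: of_bool_def sum.If_cases Int_def)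
  have "(\<Sum>\<tau>\<in>F. D \<tau>) = (\<Sum>\<tau>\<in>F. \<Sum>y\<in>M. of_bool (is_singleton (sat N w \<tau> y)))"
    by (simp only: F_M_D_def(3) F_M_D_def(2)[symmetric] cnt[OF fin(2)])
  also have "\<dots> = (\<Sum>y\<in>M. \<Sum>\<tau>\<in>F. of_bool (is_singleton (sat N w \<tau> y)))"
    by (rule sum.swap)
  also have "\<dots> = (\<Sum>y\<in>M. card {\<tau> \<in> F. is_singleton (sat N w \<tau> y)})"
    using fin(1) by (simp add: of_bool_def sum.If_cases Int_def)
  finally have "(\<Sum>\<tau>\<in>F. D \<tau>) = (\<Sum>y\<in>M. card {\<tau> \<in> F. is_singleton (sat N w \<tau> y)})" .
  moreover have "real (card M * card F) / 8 = (\<Sum>y\<in>M. real (card F) / 8)" by simp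
  moreover have "\<dots> \<le> (\<Sum>y\<in>M. real (card {\<tau> \<in> F. is_singleton (sat N w \<tau> y)}))"
    unfolding F_M_D_def N_def by (intro sum_mono unique_formulas_fraction[OF C _ w l])
  ultimately have low: "real (card M * card F) / 8 \<le> real (\<Sum>\<tau>\<in>F. D \<tau>)"
    by simp
  \<comment> \<open>A formula that is not good contributes at most 1/16 of the middle points, a good
    one at most all of them.\<close>
  have "real (\<Sum>\<tau>\<in>F. D \<tau>) \<le> (\<Sum>\<tau>\<in>F. card M / 16 + (if card M \<le> 16 * D \<tau> then real (card M) else 0))"
    unfolding of_nat_sum
  proof (rule sum_mono)
    fix \<tau>
    have "D \<tau> \<le> card M" unfolding F_M_D_def using fin by (intro card_mono) (auto simp: F_M_D_def)
    then show "real (D \<tau>) \<le> card M / 16 + (if card M \<le> 16 * D \<tau> then real (card M) else 0)" by auto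
  qed
  also have "\<dots> = card F * (card M / 16) + card (good_formulas l w C) * card M"
    using fin by (simp add: sum.distrib good sum.If_cases Int_def)
  finally have "real (card M * card F) / 8 \<le> card F * (card M / 16) + card (good_formulas l w C) * card M"
    using low by linarith
  then have "real (card M) * real (card F) \<le> real (card M) * real (16 * card (good_formulas l w C))"
    by (simp add: algebra_simps)
  then have "real (card F) \<le> real (16 * card (good_formulas l w C))"
    using \<open>card M > 0\<close> by (subst (asm) mult_le_cancel_left_pos) auto
  then show ?thesis unfolding F_M_D_def N_def by (simp only: of_nat_le_iff)
qed

section \<open>Random action variables and averaging over testers\<close>

definition choices :: "nat \<Rightarrow> nat \<Rightarrow> (nat \<Rightarrow> nat) set" where
  "choices a B = ({..<a} \<rightarrow>\<^sub>E {..<B})"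

text \<open>One coordinate from each of \<open>a\<close> consecutive blocks of length
  \<open>B\<close>. Compared with a uniform \<open>a\<close>-element set this makes the choices
  independent, so that expectations factor over blocks.\<close>

definition chosen :: "nat \<Rightarrow> nat \<Rightarrow> (nat \<Rightarrow> nat) \<Rightarrow> nat set" where
  "chosen a B \<sigma> = (\<lambda>j. j * B + \<sigma> j) ` {..<a}"

lemma finite_choices: "finite (choices a B)" and card_choices: "card (choices a B) = B ^ a"
  by (auto simp: choices_def card_PiE intro: finite_PiE)

lemma block_index_eq:
  fixes i i' j j' B :: nat
  assumes "j * B + i = j' * B + i'" "i < B" "i' < B"
  shows "j = j' \<and> i = i'"
proof -
  have "(j * B + i) div B = j" "(j' * B + i') div B = j'" using assms(2,3) by simp_all
  then show ?thesis using assms(1) by auto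
qed

lemma chosen_props:
  assumes "\<sigma> \<in> choices a B"
  shows "card (chosen a B \<sigma>) = a" "chosen a B \<sigma> \<subseteq> {..<a * B}" "inj_on (\<lambda>j. j * B + \<sigma> j) {..<a}"
proof -
  have \<sigma>: "\<sigma> j < B" if "j < a" for j using assms that by (auto simp: choices_def)
  show inj: "inj_on (\<lambda>j. j * B + \<sigma> j) {..<a}"
    by (rule inj_onI) (use \<sigma> block_index_eq in blast)
  then show "card (chosen a B \<sigma>) = a" by (simp add: chosen_def card_image)
  show "chosen a B \<sigma> \<subseteq> {..<a * B}"
  proof
    fix x assume "x \<in> chosen a B \<sigma>"
    then obtain j where "j < a" "x = j * B + \<sigma> j" by (auto simp: chosen_def)
    moreover have "(j + 1) * B \<le> a * B" using \<open>j < a\<close> by (intro mult_le_mono1) simp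
    ultimately show "x \<in> {..<a * B}" using \<sigma>[of j] by simp
  qed
qed

text \<open>The weight \<open>2\<close> of a chosen point of \<open>D\<close> is paid for by the weights \<open>exp (- 2 / B)\<close> of the
  other points of \<open>D\<close> in its block.\<close>
lemma chosen_moment:
  assumes D: "finite D" and B: "B \<ge> 8"
  shows "(\<Sum>\<sigma>\<in>choices a B. 2 ^ card (D \<inter> chosen a B \<sigma>) * exp (- (2 / B) * card (D - chosen a B \<sigma>))) \<le> real B ^ a"
proof -
  define E m where "E = exp (2 / real B)" "m = (\<lambda>j. card {i \<in> {..<B}. j * B + i \<in> D})"
  \<comment> \<open>Block \<open>j\<close> is charged for all its \<open>m j\<close> points of
    \<open>D\<close>; the factor \<open>E\<close> refunds the charge of the chosen point if it lies
    in \<open>D\<close>.\<close>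
  define f where "f j i = (if j * B + i \<in> D then 2 * E else 1) * exp (- (2 / B) * m j)" for j i
  \<comment> \<open>\<open>B \<ge> 8\<close> gives E \<le> 21/16. The average of the first factor
    over a block is then at most 1 + 2m/B, which exp(-2m/B) compensates.\<close>
  have "E \<le> 1 + 2 / B + (2 / B)\<^sup>2" unfolding E_m_def by (rule exp_bound) (use B in auto)
  also have "\<dots> \<le> 1 + 1 / 4 + (1 / 4)\<^sup>2"
    using B by (intro add_mono power_mono) (auto simp: field_simps)
  finally have E: "2 * E - 1 \<le> 2" by (simp add: power2_eq_square)
  have block: "0 \<le> (\<Sum>i<B. f j i) \<and> (\<Sum>i<B. f j i) \<le> B" for j
  proof
    show "0 \<le> (\<Sum>i<B. f j i)" by (intro sum_nonneg) (simp add: f_def E_m_def)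
    have "(\<Sum>i<B. if j * B + i \<in> D then 2 * E else 1) = (\<Sum>i<B. 1 + (2 * E - 1) * of_bool (j * B + i \<in> D))"
      by (rule sum.cong) auto
    also have "\<dots> = B + (2 * E - 1) * m j"
      by (simp add: sum.distrib sum_distrib_left[symmetric] of_bool_def sum.If_cases Int_def E_m_def)
    also have "\<dots> \<le> real B + 2 * real (m j)" using E by (intro add_left_mono mult_right_mono) auto
    also have "\<dots> = real B * (1 + 2 / B * m j)" using B by (simp add: field_simps)
    also have "\<dots> \<le> B * exp (2 / B * m j)" by (intro mult_left_mono exp_ge_add_one_self) auto
    finally have "(\<Sum>i<B. if j * B + i \<in> D then 2 * E else 1) * exp (- (2 / B) * m j)
      \<le> (B * exp (2 / B * m j)) * exp (- (2 / B) * m j)"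
      by (intro mult_right_mono) auto
    also have "\<dots> = B" by (simp add: mult.assoc flip: exp_add)
    finally show "(\<Sum>i<B. f j i) \<le> B" by (simp add: f_def sum_distrib_right)
  qed
  have "2 ^ card (D \<inter> chosen a B \<sigma>) * exp (- (2 / B) * card (D - chosen a B \<sigma>)) \<le> (\<Prod>j<a. f j (\<sigma> j))"
    if \<sigma>: "\<sigma> \<in> choices a B" for \<sigma>
  proof -
    let ?A = "chosen a B \<sigma>"
    have "D \<inter> ?A = (\<lambda>j. j * B + \<sigma> j) ` {j \<in> {..<a}. j * B + \<sigma> j \<in> D}"
      by (auto simp: chosen_def)
    moreover have "inj_on (\<lambda>j. j * B + \<sigma> j) {j \<in> {..<a}. j * B + \<sigma> j \<in> D}"
      by (rule inj_on_subset[OF chosen_props(3)[OF \<sigma>]]) auto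
    ultimately have DA: "card (D \<inter> ?A) = card {j \<in> {..<a}. j * B + \<sigma> j \<in> D}"
      by (simp only: card_image)
    have blocks: "D \<inter> {..<a * B} = (\<Union>j<a. (\<lambda>i. j * B + i) ` {i \<in> {..<B}. j * B + i \<in> D})"
    proof
      show "D \<inter> {..<a * B} \<subseteq> (\<Union>j<a. (\<lambda>i. j * B + i) ` {i \<in> {..<B}. j * B + i \<in> D})"
      proof
        fix x assume x: "x \<in> D \<inter> {..<a * B}"
        then have "x div B < a" "x mod B < B" "x = x div B * B + x mod B"
          using B by (auto simp: less_mult_imp_div_less)
        then show "x \<in> (\<Union>j<a. (\<lambda>i. j * B + i) ` {i \<in> {..<B}. j * B + i \<in> D})"
          using x by (intro UN_I[of "x div B"] image_eqI[of _ _ "x mod B"]) auto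
      qed
      show "(\<Union>j<a. (\<lambda>i. j * B + i) ` {i \<in> {..<B}. j * B + i \<in> D}) \<subseteq> D \<inter> {..<a * B}"
      proof
        fix x assume "x \<in> (\<Union>j<a. (\<lambda>i. j * B + i) ` {i \<in> {..<B}. j * B + i \<in> D})"
        then obtain j i where "j < a" "i < B" "x = j * B + i" "x \<in> D" by auto
        moreover have "(j + 1) * B \<le> a * B" using \<open>j < a\<close> by (intro mult_le_mono1) simp
        ultimately show "x \<in> D \<inter> {..<a * B}" by simp
      qed
    qed
    have "card (D \<inter> {..<a * B}) = (\<Sum>j<a. card ((\<lambda>i. j * B + i) ` {i \<in> {..<B}. j * B + i \<in> D}))"
      unfolding blocks
    proof (rule card_UN_disjoint)
      show "\<forall>j\<in>{..<a}. \<forall>j'\<in>{..<a}. j \<noteq> j' \<longrightarrow>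
        (\<lambda>i. j * B + i) ` {i \<in> {..<B}. j * B + i \<in> D} \<inter> (\<lambda>i. j' * B + i) ` {i \<in> {..<B}. j' * B + i \<in> D} = {}"
      proof (intro ballI impI equals0I)
        fix j j' x
        assume "j \<noteq> j'" and "x \<in> (\<lambda>i. j * B + i) ` {i \<in> {..<B}. j * B + i \<in> D} \<inter> (\<lambda>i. j' * B + i) ` {i \<in> {..<B}. j' * B + i \<in> D}"
        then obtain i i' where "j * B + i = j' * B + i'" "i < B" "i' < B" by auto
        then have "j = j'" using block_index_eq[of j B i j' i'] by simp
        then show False using \<open>j \<noteq> j'\<close> by simp
      qed
    qed auto
    also have "\<dots> = (\<Sum>j<a. m j)"
      unfolding E_m_def by (intro sum.cong refl card_image) (simp add: inj_on_def)
    finally have "(\<Sum>j<a. m j) = card (D \<inter> {..<a * B})" by simp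
    also have "\<dots> = card (D \<inter> {..<a * B} \<inter> ?A) + card (D \<inter> {..<a * B} - ?A)"
      by (rule card_Int_Diff) simp
    also have "D \<inter> {..<a * B} \<inter> ?A = D \<inter> ?A" using chosen_props(2)[OF \<sigma>] by auto
    \<comment> \<open>Points of \<open>D\<close> beyond the last block only decrease the
      weight.\<close>
    also have "card (D \<inter> {..<a * B} - ?A) \<le> card (D - ?A)" using D by (intro card_mono) auto
    finally have "(\<Sum>j<a. real (m j)) \<le> card (D \<inter> ?A) + card (D - ?A)"
      by (simp flip: of_nat_sum of_nat_add)
    then have "- (2 / B) * card (D - ?A) \<le> 2 / B * card (D \<inter> ?A) + (\<Sum>j<a. - (2 / B) * real (m j))"
      unfolding sum_distrib_left[symmetric]
      using mult_left_mono[of "\<Sum>j<a. real (m j)" "card (D \<inter> ?A) + card (D - ?A)" "2 / B"]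
      by (simp add: distrib_left)
    then have "exp (- (2 / B) * card (D - ?A)) \<le> exp (2 / B * card (D \<inter> ?A) + (\<Sum>j<a. - (2 / B) * real (m j)))"
      by (simp only: exp_le_cancel_iff)
    also have "\<dots> = E ^ card (D \<inter> ?A) * (\<Prod>j<a. exp (- (2 / B) * m j))"
    proof -
      have "E ^ card (D \<inter> ?A) = exp (2 / B * card (D \<inter> ?A))"
        unfolding E_m_def(1) exp_of_nat_mult[symmetric] by (simp add: mult.commute)
      then show ?thesis by (simp only: exp_add exp_sum[OF finite_lessThan])
    qed
    finally have "exp (- (2 / B) * card (D - ?A)) \<le> E ^ card (D \<inter> ?A) * (\<Prod>j<a. exp (- (2 / B) * m j))" .
    then have "2 ^ card (D \<inter> ?A) * exp (- (2 / B) * card (D - ?A))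
      \<le> 2 ^ card (D \<inter> ?A) * (E ^ card (D \<inter> ?A) * (\<Prod>j<a. exp (- (2 / B) * m j)))"
      by (intro mult_left_mono) auto
    also have "\<dots> = (2 * E) ^ card (D \<inter> ?A) * (\<Prod>j<a. exp (- (2 / B) * m j))"
      by (simp add: power_mult_distrib)
    also have "(2 * E) ^ card (D \<inter> ?A) = (\<Prod>j<a. if j * B + \<sigma> j \<in> D then 2 * E else 1)"
      unfolding DA by (simp add: prod.If_cases Int_def)
    finally show ?thesis by (simp add: f_def prod.distrib)
  qed
  then have "(\<Sum>\<sigma>\<in>choices a B. 2 ^ card (D \<inter> chosen a B \<sigma>) * exp (- (2 / B) * card (D - chosen a B \<sigma>)))
      \<le> (\<Sum>\<sigma>\<in>choices a B. \<Prod>j<a. f j (\<sigma> j))"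
    by (rule sum_mono)
  also have "\<dots> = (\<Prod>j<a. \<Sum>i<B. f j i)"
    unfolding choices_def by (subst prod_sum_PiE) auto
  also have "\<dots> \<le> (\<Prod>j<a. real B)"
    by (rule prod_mono) (use block in auto)
  finally show ?thesis by simp
qed

text \<open>The easy direction of Yao's principle. Averaged over \<open>J\<close> the acceptance
  probabilities differ by at least 1/3, while each outcome of the tester's randomness contributes a
  difference of at most \<open>K / card J\<close>.\<close>

lemma tester_average:
  fixes fy fn :: "'j \<Rightarrow> nat set \<Rightarrow> bool" and T :: na_tester and K :: real
  assumes J: "finite J"
    and yes: "\<And>j. j \<in> J \<Longrightarrow> accept_prob T (fy j) \<ge> 2 / 3"
    and no: "\<And>j. j \<in> J \<Longrightarrow> accept_prob T (fn j) \<le> 1 / 3"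
    and close: "\<And>Q d. (Q, d) \<in> set_pmf T \<Longrightarrow>
      real (card {j \<in> J. d (map (fy j) Q)}) \<le> card {j \<in> J. d (map (fn j) Q)} + K"
  shows "card J \<le> 3 * K"
proof -
  define acc where "acc f z = (of_bool (case z of (Q, d) \<Rightarrow> d (map f Q)) :: real)"
    for f :: "nat set \<Rightarrow> bool" and z :: "nat set list \<times> (bool list \<Rightarrow> bool)"
  have int: "integrable (measure_pmf T) (acc f)" for f
    by (rule measure_pmf.integrable_const_bound[where B = 1]) (auto simp: acc_def)
  have acc: "measure_pmf.expectation T (acc f) = accept_prob T f" for f
  proof -
    have "acc f = indicator {(Q, d). d (map f Q)}"
      by (auto simp: acc_def indicator_def fun_eq_iff)
    then show ?thesis by (simp add: accept_prob_def)
  qed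
  have sum: "(\<Sum>j\<in>J. acc (f j) (Q, d)) = card {j \<in> J. d (map (f j) Q)}" for f Q d
    using J by (simp add: acc_def of_bool_def sum.If_cases Int_def)
  have "(\<Sum>j\<in>J. 1 / 3) \<le> (\<Sum>j\<in>J. accept_prob T (fy j) - accept_prob T (fn j))"
    by (rule sum_mono) (use yes no in fastforce)
  also have "\<dots> = measure_pmf.expectation T (\<lambda>z. (\<Sum>j\<in>J. acc (fy j) z) - (\<Sum>j\<in>J. acc (fn j) z))"
    by (simp add: Bochner_Integration.integral_diff Bochner_Integration.integral_sum int acc sum_subtractf)
  also have "\<dots> \<le> measure_pmf.expectation T (\<lambda>z. K)"
  proof (rule integral_mono_AE)
    show "AE z in measure_pmf T. (\<Sum>j\<in>J. acc (fy j) z) - (\<Sum>j\<in>J. acc (fn j) z) \<le> K"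
      unfolding AE_measure_pmf_iff using close by (auto simp: sum algebra_simps)
  qed (use int in auto)
  finally show ?thesis by simp
qed

section \<open>Indistinguishability\<close>

text \<open>With B = 16l + 1 and w = 8s, the lower bound in \<open>fits\<close> makes room for 2s
  blocks of length B and leaves at least 4lw control variables, the summand 1 paying for the action
  variables. The upper bound gives 2/B \<le> w/(p - 2s), which matches the decay of shared terms
  with the weights in \<open>chosen_moment\<close>.\<close>

locale hard_params =
  fixes p l s k :: nat
  assumes l: "l \<ge> 1" and s: "s \<ge> 1" and k: "k \<ge> 1"
    and fits: "2 * s * (16 * l + 1) \<le> p" "p \<le> 4 * s * (16 * l + 1)"
begin

definition B :: nat where "B = 16 * l + 1"
definition w :: nat where "w = 8 * s"
definition N :: nat where "N = 2 ^ (w - 1)"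
definition codes :: "(nat \<Rightarrow> nat) set" where "codes = choices (2 * s) B"
definition action_vars :: "(nat \<Rightarrow> nat) \<Rightarrow> nat set" where "action_vars \<sigma> = chosen (2 * s) B \<sigma>"
definition control_vars :: "(nat \<Rightarrow> nat) \<Rightarrow> nat set" where "control_vars \<sigma> = {..<p} - action_vars \<sigma>"
definition high_of :: "(nat \<Rightarrow> nat \<Rightarrow> nat) \<Rightarrow> nat set \<Rightarrow> bool" where
  "high_of \<tau> = talagrand_high ((p - 2 * s) div 2) l (sat N w \<tau>)"
definition ctrl_of :: "(nat \<Rightarrow> nat \<Rightarrow> nat) \<Rightarrow> nat set \<Rightarrow> nat option" where
  "ctrl_of \<tau> = talagrand_ctrl ((p - 2 * s) div 2) l (sat N w \<tau>)"
definition hard_fn :: "bool \<Rightarrow> (nat \<Rightarrow> nat) \<Rightarrow> (nat \<Rightarrow> nat \<Rightarrow> nat) \<Rightarrow> nat set \<Rightarrow> nat set \<Rightarrow> bool" where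
  "hard_fn e \<sigma> \<tau> = hard_instance.hard p (action_vars \<sigma>) s k (high_of \<tau>) (ctrl_of \<tau>) e"
definition separated :: "(nat \<Rightarrow> nat) \<Rightarrow> (nat \<Rightarrow> nat \<Rightarrow> nat) \<Rightarrow> nat set \<Rightarrow> nat set \<Rightarrow> bool" where
  "separated \<sigma> \<tau> = hard_instance.separates p (action_vars \<sigma>) s k (ctrl_of \<tau>)"

lemma action_vars:
  assumes "\<sigma> \<in> codes"
  shows "action_vars \<sigma> \<subseteq> {..<p}" "card (action_vars \<sigma>) = 2 * s"
  using chosen_props[of \<sigma> "2 * s" B] assms fits(1) by (auto simp: codes_def action_vars_def B_def)

lemma hard_instance_of: "\<sigma> \<in> codes \<Longrightarrow> hard_instance p (action_vars \<sigma>) s k (high_of \<tau>) (ctrl_of \<tau>)"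
  unfolding high_of_def ctrl_of_def using action_vars k by (intro hard_instance_talagrand) auto

lemma control_vars:
  assumes "\<sigma> \<in> codes"
  shows "finite (control_vars \<sigma>)" "card (control_vars \<sigma>) = p - 2 * s" "hard_instance.C p (action_vars \<sigma>) = control_vars \<sigma>"
proof -
  \<comment> \<open>\<open>C\<close> depends only on \<open>p\<close> and the action variables, so
    any formula will do, here \<open>undefined\<close>.\<close>
  interpret hard_instance p "action_vars \<sigma>" s k "high_of undefined" "ctrl_of undefined" by (rule hard_instance_of[OF assms])
  show "hard_instance.C p (action_vars \<sigma>) = control_vars \<sigma>" by (simp add: C_def control_vars_def)
qed (use action_vars[OF assms] in \<open>auto simp: control_vars_def card_Diff_subset finite_subset\<close>)

lemma parameter_bounds: "4 * l * w \<le> p - 2 * s" "w \<ge> 1" "p - 2 * s \<ge> 1" "2 / B \<le> w / (p - 2 * s)" "2 * s \<le> p"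
proof -
  have 1: "2 * s * (16 * l + 1) = 4 * l * w + 2 * s" by (simp add: w_def algebra_simps)
  then show "4 * l * w \<le> p - 2 * s" "2 * s \<le> p" using fits(1) by linarith+
  show "w \<ge> 1" using s by (simp add: w_def)
  moreover have "1 * 1 \<le> l * w" using l \<open>w \<ge> 1\<close> by (intro mult_le_mono) auto
  ultimately show c: "p - 2 * s \<ge> 1" using \<open>4 * l * w \<le> p - 2 * s\<close> unfolding mult.assoc by linarith
  have "2 * (p - 2 * s) \<le> w * B" using fits(2) by (simp add: w_def B_def algebra_simps)
  then have "2 * real (p - 2 * s) \<le> real w * real B"
    by (metis of_nat_le_iff of_nat_mult of_nat_numeral)
  moreover have "2 / y \<le> z / x" if "2 * x \<le> z * y" "x > 0" "y > 0" for x y z :: real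
    using that by (simp add: field_simps)
  ultimately show "2 / B \<le> w / (p - 2 * s)" using c by (simp add: B_def)
qed

lemma ctrl_of_neq_None:
  assumes "\<sigma> \<in> codes"
  shows "ctrl_of \<tau> (x \<inter> control_vars \<sigma>) \<noteq> None \<longleftrightarrow> x \<inter> control_vars \<sigma> \<in> mid_layers l (control_vars \<sigma>) \<and> is_singleton (sat N w \<tau> (x \<inter> control_vars \<sigma>))"
  unfolding ctrl_of_def talagrand_ctrl_neq_None mid_layers_def using control_vars(2)[OF assms] by auto

text \<open>If separation is possible at all, \<open>D\<close> contains at least 2k action
  variables, so the factor (1/4)^k 2^|D \<inter> A|, with A the action variables, is at least 1 and
  may be inserted. The rest bounds the chance of a common term, and the product is the weight of
  \<open>chosen_moment\<close>.\<close>

lemma separates_fraction: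
  fixes x y :: "nat set"
  assumes \<sigma>: "\<sigma> \<in> codes"
  defines "D \<equiv> sym_diff x y \<inter> {..<p}"
  shows "real (card {\<tau> \<in> formulas N w (control_vars \<sigma>). separated \<sigma> \<tau> x y})
    \<le> (1 / 4) ^ k * card (formulas N w (control_vars \<sigma>)) * (2 ^ card (D \<inter> action_vars \<sigma>) * exp (- (2 / B) * card (D - action_vars \<sigma>)))"
proof (cases "{\<tau> \<in> formulas N w (control_vars \<sigma>). separated \<sigma> \<tau> x y} = {}")
  case False
  have separated: "ctrl_of \<tau> (x \<inter> control_vars \<sigma>) \<noteq> None \<and> ctrl_of \<tau> (x \<inter> control_vars \<sigma>) = ctrl_of \<tau> (y \<inter> control_vars \<sigma>) \<and>
      card (x \<inter> action_vars \<sigma>) + k \<le> s \<and> s + k \<le> card (y \<inter> action_vars \<sigma>)" if "separated \<sigma> \<tau> x y" for \<tau>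
    using that unfolding separated_def hard_instance.separates_def[OF hard_instance_of[OF \<sigma>]] control_vars(3)[OF \<sigma>] .
  obtain \<tau>0 where \<tau>0: "separated \<sigma> \<tau>0 x y" using False by auto
  have mid: "x \<inter> control_vars \<sigma> \<in> mid_layers l (control_vars \<sigma>)" "y \<inter> control_vars \<sigma> \<in> mid_layers l (control_vars \<sigma>)"
    using separated[OF \<tau>0] ctrl_of_neq_None[OF \<sigma>] by metis+
  have finA: "finite (action_vars \<sigma>)" using action_vars(1)[OF \<sigma>] finite_subset by auto
  have "y \<inter> action_vars \<sigma> \<subseteq> (x \<inter> action_vars \<sigma>) \<union> (D \<inter> action_vars \<sigma>)"
    using action_vars(1)[OF \<sigma>] by (auto simp: D_def)
  then have "card (y \<inter> action_vars \<sigma>) \<le> card ((x \<inter> action_vars \<sigma>) \<union> (D \<inter> action_vars \<sigma>))"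
    using finA by (intro card_mono) auto
  also have "\<dots> \<le> card (x \<inter> action_vars \<sigma>) + card (D \<inter> action_vars \<sigma>)" by (rule card_Un_le)
  finally have "2 * k \<le> card (D \<inter> action_vars \<sigma>)" using separated[OF \<tau>0] by linarith
  then have "(2::real) ^ (2 * k) \<le> 2 ^ card (D \<inter> action_vars \<sigma>)" by (intro power_increasing) auto
  then have one: "1 \<le> (1 / 4) ^ k * (2::real) ^ card (D \<inter> action_vars \<sigma>)"
    using power_mult[of "2::real" 2 k] by (simp add: power_divide)
  have "sat N w \<tau> (x \<inter> control_vars \<sigma>) \<inter> sat N w \<tau> (y \<inter> control_vars \<sigma>) \<noteq> {}" if \<tau>: "separated \<sigma> \<tau> x y" for \<tau>
  proof -
    obtain i where "ctrl_of \<tau> (x \<inter> control_vars \<sigma>) = Some i" "ctrl_of \<tau> (y \<inter> control_vars \<sigma>) = Some i"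
      using separated[OF \<tau>] by auto
    then show ?thesis by (auto simp: ctrl_of_def talagrand_ctrl_eq_Some)
  qed
  then have "real (card {\<tau> \<in> formulas N w (control_vars \<sigma>). separated \<sigma> \<tau> x y}) \<le>
      real (card {\<tau> \<in> formulas N w (control_vars \<sigma>). sat N w \<tau> (x \<inter> control_vars \<sigma>) \<inter> sat N w \<tau> (y \<inter> control_vars \<sigma>) \<noteq> {}})"
    using finite_formulas[OF control_vars(1)[OF \<sigma>]] by (intro of_nat_mono card_mono) auto
  also have "\<dots> \<le> exp (- (w / card (control_vars \<sigma>)) * card (sym_diff (x \<inter> control_vars \<sigma>) (y \<inter> control_vars \<sigma>))) * card (formulas N w (control_vars \<sigma>))"
    unfolding N_def by (rule common_formulas_fraction[OF _ mid])
      (use control_vars[OF \<sigma>] parameter_bounds in \<open>auto simp: card_gt_0_iff\<close>)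
  also have "sym_diff (x \<inter> control_vars \<sigma>) (y \<inter> control_vars \<sigma>) = D - action_vars \<sigma>"
    by (auto simp: D_def control_vars_def)
  also have "exp (- (w / card (control_vars \<sigma>)) * card (D - action_vars \<sigma>)) \<le> exp (- (2 / B) * card (D - action_vars \<sigma>))"
    unfolding exp_le_cancel_iff control_vars(2)[OF \<sigma>] using parameter_bounds(4) by (intro mult_right_mono) auto
  also have "\<dots> \<le> ((1 / 4) ^ k * 2 ^ card (D \<inter> action_vars \<sigma>)) * exp (- (2 / B) * card (D - action_vars \<sigma>))"
    using mult_right_mono[OF one, of "exp (- (2 / B) * card (D - action_vars \<sigma>))"] by simp
  finally show ?thesis by (simp add: mult_ac mult_right_mono)
next
  case True
  show ?thesis unfolding True by simp
qed

text \<open>The number of all pairs of a code and a formula; every code leaves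
  \<open>p - 2 * s\<close> control variables.\<close>

definition total :: real where "total = real B ^ (2 * s) * real ((p - 2 * s) ^ w) ^ N"

lemma separates_total:
  "(\<Sum>\<sigma>\<in>codes. real (card {\<tau> \<in> formulas N w (control_vars \<sigma>). separated \<sigma> \<tau> x y})) \<le> (1 / 4) ^ k * total"
proof -
  define D where "D = sym_diff x y \<inter> {..<p}"
  have "(\<Sum>\<sigma>\<in>codes. real (card {\<tau> \<in> formulas N w (control_vars \<sigma>). separated \<sigma> \<tau> x y})) \<le>
    (\<Sum>\<sigma>\<in>codes. (1 / 4) ^ k * real ((p - 2 * s) ^ w) ^ N * (2 ^ card (D \<inter> action_vars \<sigma>) * exp (- (2 / B) * card (D - action_vars \<sigma>))))"
  proof (rule sum_mono)
    fix \<sigma> assume \<sigma>: "\<sigma> \<in> codes"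
    have "real (card (formulas N w (control_vars \<sigma>))) = real ((p - 2 * s) ^ w) ^ N"
      by (simp add: card_formulas control_vars(2)[OF \<sigma>])
    then show "real (card {\<tau> \<in> formulas N w (control_vars \<sigma>). separated \<sigma> \<tau> x y}) \<le>
      (1 / 4) ^ k * real ((p - 2 * s) ^ w) ^ N * (2 ^ card (D \<inter> action_vars \<sigma>) * exp (- (2 / B) * card (D - action_vars \<sigma>)))"
      using separates_fraction[OF \<sigma>, of x y] unfolding D_def by simp
  qed
  also have "\<dots> = (1 / 4) ^ k * real ((p - 2 * s) ^ w) ^ N *
      (\<Sum>\<sigma>\<in>codes. 2 ^ card (D \<inter> action_vars \<sigma>) * exp (- (2 / B) * card (D - action_vars \<sigma>)))"
    by (rule sum_distrib_left[symmetric])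
  also have "\<dots> \<le> (1 / 4) ^ k * real ((p - 2 * s) ^ w) ^ N * real B ^ (2 * s)"
    unfolding codes_def action_vars_def using l
    by (intro mult_left_mono chosen_moment) (auto simp: D_def B_def)
  finally show ?thesis by (simp add: total_def mult_ac)
qed

section \<open>Restriction to good formulas and the query bound\<close>

definition instances :: "((nat \<Rightarrow> nat) \<times> (nat \<Rightarrow> nat \<Rightarrow> nat)) set" where
  "instances = (SIGMA \<sigma>:codes. good_formulas l w (control_vars \<sigma>))"

lemma finite_instances: "finite instances"
proof -
  have "finite (good_formulas l w (control_vars \<sigma>))" if "\<sigma> \<in> codes" for \<sigma>
    using finite_formulas[OF control_vars(1)[OF that]] by (simp add: good_formulas_def)
  then show ?thesis by (auto simp: instances_def codes_def finite_choices)
qed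

lemma card_instances: "total \<le> 16 * real (card instances)"
proof -
  have "total = (\<Sum>\<sigma>\<in>codes. real (card (formulas N w (control_vars \<sigma>))))"
    by (simp add: card_formulas control_vars(2) total_def codes_def card_choices)
  also have "\<dots> \<le> (\<Sum>\<sigma>\<in>codes. 16 * real (card (good_formulas l w (control_vars \<sigma>))))"
  proof (rule sum_mono)
    fix \<sigma> assume \<sigma>: "\<sigma> \<in> codes"
    have "real (card (formulas N w (control_vars \<sigma>))) \<le> real (16 * card (good_formulas l w (control_vars \<sigma>)))"
      unfolding N_def using parameter_bounds l control_vars[OF \<sigma>] by (intro of_nat_mono card_good_formulas) auto
    then show "real (card (formulas N w (control_vars \<sigma>))) \<le> 16 * real (card (good_formulas l w (control_vars \<sigma>)))" by simp
  qed
  also have "\<dots> = 16 * (\<Sum>\<sigma>\<in>codes. real (card (good_formulas l w (control_vars \<sigma>))))"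
    by (rule sum_distrib_left[symmetric])
  also have "(\<Sum>\<sigma>\<in>codes. real (card (good_formulas l w (control_vars \<sigma>)))) = card instances"
  proof -
    have "finite (good_formulas l w (control_vars \<sigma>))" if "\<sigma> \<in> codes" for \<sigma>
      using finite_formulas[OF control_vars(1)[OF that]] by (simp add: good_formulas_def)
    then show ?thesis
      unfolding instances_def by (subst card_SigmaI) (auto simp: codes_def finite_choices)
  qed
  finally show ?thesis .
qed

text \<open>Union bound over ordered pairs of queries. It runs over all formulas, of which the good
  ones are a subset, because the moment bound averages over all of them.\<close>

lemma separating_instances:
  assumes X: "finite X" "card X \<le> q"
  shows "real (card {(\<sigma>, \<tau>) \<in> instances. \<exists>x\<in>X. \<exists>y\<in>X. separated \<sigma> \<tau> x y}) \<le> real q ^ 2 * ((1 / 4) ^ k * total)"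
proof -
  have fin: "finite codes" "\<sigma> \<in> codes \<Longrightarrow> finite (formulas N w (control_vars \<sigma>))" for \<sigma>
    by (simp_all add: codes_def finite_choices finite_formulas control_vars)
  have "{(\<sigma>, \<tau>) \<in> instances. \<exists>x\<in>X. \<exists>y\<in>X. separated \<sigma> \<tau> x y} \<subseteq>
    (\<Union>(x, y)\<in>X \<times> X. SIGMA \<sigma>:codes. {\<tau> \<in> formulas N w (control_vars \<sigma>). separated \<sigma> \<tau> x y})"
    by (fastforce simp: instances_def good_formulas_def N_def)
  then have "card {(\<sigma>, \<tau>) \<in> instances. \<exists>x\<in>X. \<exists>y\<in>X. separated \<sigma> \<tau> x y} \<le>
    card (\<Union>(x, y)\<in>X \<times> X. SIGMA \<sigma>:codes. {\<tau> \<in> formulas N w (control_vars \<sigma>). separated \<sigma> \<tau> x y})"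
    using X fin by (intro card_mono) auto
  also have "\<dots> \<le> (\<Sum>(x, y)\<in>X \<times> X. card (SIGMA \<sigma>:codes. {\<tau> \<in> formulas N w (control_vars \<sigma>). separated \<sigma> \<tau> x y}))"
    using card_UN_le[of "X \<times> X" "\<lambda>(x, y). SIGMA \<sigma>:codes. {\<tau> \<in> formulas N w (control_vars \<sigma>). separated \<sigma> \<tau> x y}"] X
    by (simp add: case_prod_beta)
  also have "\<dots> = (\<Sum>(x, y)\<in>X \<times> X. \<Sum>\<sigma>\<in>codes. card {\<tau> \<in> formulas N w (control_vars \<sigma>). separated \<sigma> \<tau> x y})"
    using fin by (intro sum.cong refl) (auto simp: card_SigmaI)
  finally have "real (card {(\<sigma>, \<tau>) \<in> instances. \<exists>x\<in>X. \<exists>y\<in>X. separated \<sigma> \<tau> x y}) \<le>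
      real (\<Sum>(x, y)\<in>X \<times> X. \<Sum>\<sigma>\<in>codes. card {\<tau> \<in> formulas N w (control_vars \<sigma>). separated \<sigma> \<tau> x y})"
    by (rule of_nat_mono)
  also have "\<dots> = (\<Sum>(x, y)\<in>X \<times> X. \<Sum>\<sigma>\<in>codes. real (card {\<tau> \<in> formulas N w (control_vars \<sigma>). separated \<sigma> \<tau> x y}))"
    by (simp add: case_prod_beta)
  also have "\<dots> \<le> (\<Sum>(x, y)\<in>X \<times> X. (1 / 4) ^ k * total)"
    by (rule sum_mono) (use separates_total in auto)
  also have "\<dots> = real (card X) ^ 2 * ((1 / 4) ^ k * total)"
    by (simp add: card_cartesian_product power2_eq_square case_prod_beta)
  also have "\<dots> \<le> real q ^ 2 * ((1 / 4) ^ k * total)"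
    using X by (intro mult_right_mono power_mono) (auto simp: total_def)
  finally show ?thesis .
qed

text \<open>By \<open>hard_flip\<close>, flipping the secret bits in \<open>F\<close> carries the
  far answers to the close ones. Identifiers are below \<open>N\<close>, so the flip is an
  involution of \<open>Pow {..<N}\<close> and preserves counts.\<close>

lemma nonseparating_answers:
  assumes \<sigma>: "\<sigma> \<in> codes" and nosep: "\<not> (\<exists>x\<in>set Q. \<exists>y\<in>set Q. separated \<sigma> \<tau> x y)"
  shows "card {b \<in> Pow {..<N}. d (map (hard_fn True \<sigma> \<tau> b) Q)} = card {b \<in> Pow {..<N}. d (map (hard_fn False \<sigma> \<tau> b) Q)}"
proof -
  interpret hard_instance p "action_vars \<sigma>" s k "high_of \<tau>" "ctrl_of \<tau>" by (rule hard_instance_of[OF \<sigma>])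
  define F where "F = {i. \<exists>x\<in>set Q. ctrl_of \<tau> (x \<inter> C) = Some i \<and> card (x \<inter> action_vars \<sigma>) + k \<le> s}"
  have "F \<subseteq> {..<N}"
    by (auto simp: F_def ctrl_of_def talagrand_ctrl_eq_Some sat_def) 
  then have flip: "sym_diff b F \<in> Pow {..<N}" "sym_diff (sym_diff b F) F = b" if "b \<in> Pow {..<N}" for b
    using that by auto
  have "map (hard_fn False \<sigma> \<tau> b) Q = map (hard_fn True \<sigma> \<tau> (sym_diff b F)) Q" for b
    unfolding hard_fn_def by (rule map_cong[OF refl], rule hard_flip[OF _ _ F_def]) (use nosep in \<open>auto simp: separated_def\<close>)
  note eq = this
  show ?thesis unfolding eq
    by (rule card_Collect_involution[where S = "Pow {..<N}" and \<phi> = "\<lambda>b. sym_diff b F"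
        and Q = "\<lambda>b. d (map (hard_fn True \<sigma> \<tau> b) Q)", symmetric]) (fact flip)+
qed

text \<open>Average over uniform instances and secret sets. The families differ only on separating
  instances, where all \<open>2 ^ N\<close> secret sets are given up. The constant 48 is 3 from
  \<open>tester_average\<close> times 16 from \<open>card_instances\<close>.\<close>

lemma query_lower_bound:
  assumes T: "nonadaptive_tester (p + 2) q T"
    and yes: "\<And>\<sigma> \<tau> b. (\<sigma>, \<tau>) \<in> instances \<Longrightarrow> accept_prob T (hard_fn True \<sigma> \<tau> b) \<ge> 2 / 3"
    and no: "\<And>\<sigma> \<tau> b. (\<sigma>, \<tau>) \<in> instances \<Longrightarrow> accept_prob T (hard_fn False \<sigma> \<tau> b) \<le> 1 / 3"
  shows "4 ^ k \<le> 48 * real q ^ 2"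
proof -
  let ?P = "Pow {..<N}"
  define K where "K = real q ^ 2 * ((1 / 4) ^ k * total) * 2 ^ N"
  have count: "card {j \<in> instances \<times> ?P. d (map ((\<lambda>((\<sigma>, \<tau>), b). hard_fn e \<sigma> \<tau> b) j) Q)} =
      (\<Sum>(\<sigma>, \<tau>)\<in>instances. card {b \<in> ?P. d (map (hard_fn e \<sigma> \<tau> b) Q)})" for e d Q
  proof -
    have "{j \<in> instances \<times> ?P. d (map ((\<lambda>((\<sigma>, \<tau>), b). hard_fn e \<sigma> \<tau> b) j) Q)} =
      (SIGMA z:instances. {b \<in> ?P. d (map (hard_fn e (fst z) (snd z) b) Q)})" by auto
    then show ?thesis using finite_instances by (simp add: card_SigmaI case_prod_beta)
  qed
  have "card (instances \<times> ?P) \<le> 3 * K"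
  proof (rule tester_average[where T = T and fy = "\<lambda>((\<sigma>, \<tau>), b). hard_fn True \<sigma> \<tau> b" and fn = "\<lambda>((\<sigma>, \<tau>), b). hard_fn False \<sigma> \<tau> b"])
    fix Q d assume "(Q, d) \<in> set_pmf T"
    then have "length Q \<le> q" using T by (auto simp: nonadaptive_tester_def)
    then have X: "card (set Q) \<le> q" using card_length[of Q] by linarith
    define bad where "bad = (\<lambda>(\<sigma>, \<tau>). \<exists>x\<in>set Q. \<exists>y\<in>set Q. separated \<sigma> \<tau> x y)"
    have each: "card {b \<in> ?P. d (map (hard_fn True \<sigma> \<tau> b) Q)} \<le>
      card {b \<in> ?P. d (map (hard_fn False \<sigma> \<tau> b) Q)} + (if bad (\<sigma>, \<tau>) then 2 ^ N else 0)"
      if "(\<sigma>, \<tau>) \<in> instances" for \<sigma> \<tau>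
    proof (cases "bad (\<sigma>, \<tau>)")
      case True
      have "card {b \<in> ?P. d (map (hard_fn True \<sigma> \<tau> b) Q)} \<le> card ?P" by (intro card_mono) auto
      then show ?thesis using True by (simp add: card_Pow)
    next
      case False
      then show ?thesis using nonseparating_answers[of \<sigma> Q \<tau> d] that by (auto simp: bad_def instances_def)
    qed
    have "(\<Sum>(\<sigma>, \<tau>)\<in>instances. card {b \<in> ?P. d (map (hard_fn True \<sigma> \<tau> b) Q)}) \<le>
      (\<Sum>z\<in>instances. (case z of (\<sigma>, \<tau>) \<Rightarrow> card {b \<in> ?P. d (map (hard_fn False \<sigma> \<tau> b) Q)}) + (if bad z then 2 ^ N else 0))"
    proof (rule sum_mono)
      fix z assume "z \<in> instances"
      moreover obtain \<sigma> \<tau> where "z = (\<sigma>, \<tau>)" by (cases z)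
      ultimately show "(case z of (\<sigma>, \<tau>) \<Rightarrow> card {b \<in> ?P. d (map (hard_fn True \<sigma> \<tau> b) Q)}) \<le>
        (case z of (\<sigma>, \<tau>) \<Rightarrow> card {b \<in> ?P. d (map (hard_fn False \<sigma> \<tau> b) Q)}) + (if bad z then 2 ^ N else 0)"
        using each[of \<sigma> \<tau>] by (simp only: case_prod_conv)
    qed
    also have "\<dots> = (\<Sum>(\<sigma>, \<tau>)\<in>instances. card {b \<in> ?P. d (map (hard_fn False \<sigma> \<tau> b) Q)}) + card {z \<in> instances. bad z} * 2 ^ N"
      using finite_instances by (simp add: sum.distrib sum.If_cases Int_def)
    finally have "real (\<Sum>(\<sigma>, \<tau>)\<in>instances. card {b \<in> ?P. d (map (hard_fn True \<sigma> \<tau> b) Q)}) \<le>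
      real ((\<Sum>(\<sigma>, \<tau>)\<in>instances. card {b \<in> ?P. d (map (hard_fn False \<sigma> \<tau> b) Q)}) + card {z \<in> instances. bad z} * 2 ^ N)"
      by (rule of_nat_mono)
    moreover have "real (card {z \<in> instances. bad z}) * 2 ^ N \<le> K"
      unfolding K_def
    proof (rule mult_right_mono)
      have "{z \<in> instances. bad z} = {(\<sigma>, \<tau>) \<in> instances. \<exists>x\<in>set Q. \<exists>y\<in>set Q. separated \<sigma> \<tau> x y}"
        by (auto simp: bad_def)
      then show "real (card {z \<in> instances. bad z}) \<le> (real q)\<^sup>2 * ((1 / 4) ^ k * total)"
        using separating_instances[OF _ X] by simp
    qed simp
    ultimately show "real (card {j \<in> instances \<times> ?P. d (map ((\<lambda>((\<sigma>, \<tau>), b). hard_fn True \<sigma> \<tau> b) j) Q)}) \<le>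
      card {j \<in> instances \<times> ?P. d (map ((\<lambda>((\<sigma>, \<tau>), b). hard_fn False \<sigma> \<tau> b) j) Q)} + K"
      unfolding count by simp
  qed (use finite_instances yes no in auto)
  then have "real (card instances) * 2 ^ N \<le> 3 * K"
    by (simp add: card_cartesian_product card_Pow)
  moreover have "total * 2 ^ N \<le> (16 * real (card instances)) * 2 ^ N"
    using card_instances by (intro mult_right_mono) auto
  ultimately have "total * 2 ^ N \<le> 48 * K" by linarith
  then have "(total * 2 ^ N) * 1 \<le> (total * 2 ^ N) * (48 * real q ^ 2 * (1 / 4) ^ k)"
    unfolding K_def by (simp add: mult_ac)
  moreover have "total * 2 ^ N > 0"
    using parameter_bounds(3) by (simp add: total_def B_def)
  ultimately have "1 \<le> 48 * real q ^ 2 * (1 / 4) ^ k"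
    by (subst (asm) mult_le_cancel_left_pos) auto
  then show ?thesis by (simp add: power_divide field_simps)
qed

end

section \<open>Distances and the choice of parameters\<close>

lemma card_middle_band:
  assumes A: "finite A" "card A = 2 * s"
  shows "card (middle_band s k A) \<le> 2 * k * (2 * s choose s)"
proof -
  have layer: "card {u. u \<subseteq> A \<and> card u = j} = 2 * s choose j" for j
    using n_subsets[OF A(1)] A(2) by simp
  have "middle_band s k A \<subseteq> (\<Union>j\<in>{s - k..<s + k}. {u. u \<subseteq> A \<and> card u = j})"
    by (auto simp: middle_band_def)
  then have "card (middle_band s k A) \<le> card (\<Union>j\<in>{s - k..<s + k}. {u. u \<subseteq> A \<and> card u = j})"
    using A by (intro card_mono) auto
  also have "\<dots> \<le> (\<Sum>j\<in>{s - k..<s + k}. 2 * s choose j)"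
    unfolding layer[symmetric] by (rule card_UN_le) simp
  also have "\<dots> \<le> (\<Sum>j\<in>{s - k..<s + k}. 2 * s choose s)"
    by (rule sum_mono) (rule binomial_maximum')
  also have "\<dots> = (s + k - (s - k)) * (2 * s choose s)" by simp
  also have "\<dots> \<le> 2 * k * (2 * s choose s)" by (rule mult_le_mono1) linarith
  finally show ?thesis .
qed

text \<open>At most 2k layers, each a fraction of at most 1/sqrt(2s) of the cube.\<close>

lemma card_middle_band_fraction:
  assumes A: "finite A" "card A = 2 * s" and s: "s \<ge> 1" and k: "200 * real k \<le> sqrt (2 * s)"
  shows "real (card (middle_band s k A)) \<le> 2 ^ (2 * s) / 100"
proof -
  have "real (card (middle_band s k A)) \<le> real (2 * k * (2 * s choose s))"
    using card_middle_band[OF A] by (rule of_nat_mono)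
  also have "\<dots> = 2 * real k * real (2 * s choose s)" by simp
  also have "\<dots> \<le> 2 * real k * (2 ^ (2 * s) / sqrt (2 * s))"
    using middle_binomial_bounds(1)[of "2 * s"] s by (intro mult_left_mono) auto
  also have "\<dots> = (2 * real k / sqrt (2 * s)) * 2 ^ (2 * s)" by simp
  also have "\<dots> \<le> (1 / 100) * 2 ^ (2 * s)"
    using k s by (intro mult_right_mono) (auto simp: divide_le_eq)
  finally show ?thesis by simp
qed

section \<open>Mass of the layers just below the middle\<close>

definition layer_sum :: "nat \<Rightarrow> nat \<Rightarrow> nat" where
  "layer_sum c l = (\<Sum>j<l. c choose (c div 2 - j))"

lemma card_mid_layers:
  assumes C: "finite C" and l: "l \<le> card C div 2"
  shows "card (mid_layers l C) = layer_sum (card C) l"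
proof -
  define m where "m = card C div 2"
  have "mid_layers l C = (\<Union>j<l. {y. y \<subseteq> C \<and> card y = m - j})"
  proof
    show "mid_layers l C \<subseteq> (\<Union>j<l. {y. y \<subseteq> C \<and> card y = m - j})"
    proof
      fix y assume y: "y \<in> mid_layers l C"
      then have "m - card y < l" "y \<subseteq> C" "card y = m - (m - card y)" by (auto simp: mid_layers_def m_def)
      then show "y \<in> (\<Union>j<l. {y. y \<subseteq> C \<and> card y = m - j})" by blast
    qed
    show "(\<Union>j<l. {y. y \<subseteq> C \<and> card y = m - j}) \<subseteq> mid_layers l C"
      using l by (auto simp: mid_layers_def m_def)
  qed
  also have "card \<dots> = (\<Sum>j<l. card {y. y \<subseteq> C \<and> card y = m - j})"
  proof (rule card_UN_disjoint)
    \<comment> \<open>\<open>l \<le> m\<close> keeps the subtractions \<open>m - j\<close> from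
      truncating, so the sizes are distinct.\<close>
    show "\<forall>i\<in>{..<l}. \<forall>j\<in>{..<l}. i \<noteq> j \<longrightarrow> {y. y \<subseteq> C \<and> card y = m - i} \<inter> {y. y \<subseteq> C \<and> card y = m - j} = {}"
      using l by (auto simp: m_def)
  qed (use C in auto)
  finally show ?thesis using n_subsets[OF C] by (simp add: layer_sum_def m_def)
qed

text \<open>The last layer has offset l - 1, and 8(l-1)^2 \<le> c makes every layer at least half as
  large as the middle one.\<close>

lemma layer_sum_bounds:
  assumes c: "c \<ge> 1" and l: "l \<le> c div 2" "l \<ge> 1" "8 * (real l - 1) ^ 2 \<le> c"
  shows "layer_sum c l / 2 ^ c \<le> l / sqrt c" "l / (4 * sqrt c) \<le> layer_sum c l / 2 ^ c"
proof -
  have "real (layer_sum c l) \<le> (\<Sum>j<l. 2 ^ c / sqrt c)"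
    unfolding layer_sum_def of_nat_sum
  proof (rule sum_mono)
    fix j
    have "real (c choose (c div 2 - j)) \<le> real (c choose (c div 2))"
      using binomial_maximum by (rule of_nat_mono)
    also have "\<dots> \<le> 2 ^ c / sqrt c" by (rule middle_binomial_bounds[OF c])
    finally show "real (c choose (c div 2 - j)) \<le> 2 ^ c / sqrt c" .
  qed
  then show "layer_sum c l / 2 ^ c \<le> l / sqrt c" by (simp add: field_simps)
  have "(\<Sum>j<l. 2 ^ c / (4 * sqrt c)) \<le> real (layer_sum c l)"
    unfolding layer_sum_def of_nat_sum
  proof (rule sum_mono)
    fix j assume "j \<in> {..<l}"
    then have j: "real j \<le> real l - 1" "j \<le> c div 2" using l by auto
    have "real j ^ 2 \<le> (real l - 1) ^ 2" using j by (intro power_mono) auto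
    then have "8 * real j ^ 2 \<le> c" using l by linarith
    then have "1 / 2 \<le> 1 - 4 * real j ^ 2 / c" using c by (simp add: field_simps)
    then have "1 / 2 * (2 ^ c / (2 * sqrt c)) \<le> (1 - 4 * real j ^ 2 / c) * real (c choose (c div 2))"
      using middle_binomial_bounds(2)[OF c] by (intro mult_mono) auto
    also have "\<dots> \<le> real (c choose (c div 2 - j))" by (rule near_middle_binomial[OF j(2)])
    finally show "2 ^ c / (4 * sqrt c) \<le> real (c choose (c div 2 - j))" by simp
  qed
  then show "l / (4 * sqrt c) \<le> layer_sum c l / 2 ^ c" by (simp add: field_simps)
qed

lemma bdist_nonneg: "0 \<le> bdist n f g"
  by (simp add: bdist_def)

lemma dist_class_le: "P g \<Longrightarrow> dist_class n P f \<le> bdist n f g"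
  unfolding dist_class_def by (rule cInf_lower) (auto intro!: bdd_belowI[of _ 0] simp: bdist_nonneg)

text \<open>\<open>P g\<close> makes the set of distances nonempty; the infimum of the empty set of
  reals carries no information.\<close>

lemma dist_class_ge:
  assumes "P g" "\<And>g. P g \<Longrightarrow> e \<le> bdist n f g"
  shows "e \<le> dist_class n P f"
  unfolding dist_class_def by (rule cInf_greatest) (use assms in auto)

lemma monotone_imp_unate: "monotone_bf n g \<Longrightarrow> unate_bf n g"
  unfolding unate_bf_def by (rule bexI[of _ "{}"]) (auto simp: cube_def)

section \<open>Distances of the two families from monotone and unate functions\<close>

context hard_params
begin

text \<open>The fraction of the control cube on which identifiers are possible, the scale of all
  distances below.\<close>

definition mass :: real where "mass = layer_sum (p - 2 * s) l / 2 ^ (p - 2 * s)"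

lemma layers_le_half: "l \<le> (p - 2 * s) div 2"
proof -
  have "4 * l * 1 \<le> 4 * l * w" using parameter_bounds(2) by (intro mult_le_mono) auto
  then show ?thesis using parameter_bounds(1) by linarith
qed

lemma card_ids_bounds:
  assumes "(\<sigma>, \<tau>) \<in> instances"
  shows "card (hard_instance.ids p (action_vars \<sigma>) (ctrl_of \<tau>)) \<le> layer_sum (p - 2 * s) l"
    and "layer_sum (p - 2 * s) l \<le> 16 * card (hard_instance.ids p (action_vars \<sigma>) (ctrl_of \<tau>))"
proof -
  have \<sigma>: "\<sigma> \<in> codes" and \<tau>: "\<tau> \<in> good_formulas l w (control_vars \<sigma>)" using assms by (auto simp: instances_def)
  interpret hard_instance p "action_vars \<sigma>" s k "high_of \<tau>" "ctrl_of \<tau>" by (rule hard_instance_of[OF \<sigma>])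
  have L: "card (mid_layers l (control_vars \<sigma>)) = layer_sum (p - 2 * s) l"
    using card_mid_layers[OF control_vars(1)[OF \<sigma>], of l] control_vars(2)[OF \<sigma>] layers_le_half by simp
  have "ctrl_of \<tau> y \<noteq> None \<longleftrightarrow> y \<in> mid_layers l (control_vars \<sigma>) \<and> is_singleton (sat N w \<tau> y)" if "y \<subseteq> control_vars \<sigma>" for y
    using ctrl_of_neq_None[OF \<sigma>, of \<tau> y] that by (simp add: Int_absorb2)
  then have ids_eq: "ids = {y \<in> mid_layers l (control_vars \<sigma>). is_singleton (sat N w \<tau> y)}"
    unfolding ids_def control_vars(3)[OF \<sigma>] by (auto simp: mid_layers_def)
  have fin: "finite (mid_layers l (control_vars \<sigma>))" using control_vars(1)[OF \<sigma>] by (simp add: mid_layers_def)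
  show "card ids \<le> layer_sum (p - 2 * s) l"
    unfolding ids_eq L[symmetric] using fin by (intro card_mono) auto
  show "layer_sum (p - 2 * s) l \<le> 16 * card ids"
    using \<tau> unfolding ids_eq L[symmetric] by (simp add: good_formulas_def N_def)
qed

lemma cube_size: "(2::real) ^ (p + 2) = 4 * (2 ^ (p - 2 * s) * 2 ^ (2 * s))"
  using parameter_bounds(5) by (simp flip: power_add)

text \<open>1/400 is the band fraction 1/100 times 1/4, since only one of the four switch settings
  can disagree.\<close>

lemma hard_fn_True_close:
  assumes "(\<sigma>, \<tau>) \<in> instances" and k_small: "200 * real k \<le> sqrt (2 * s)"
    and P: "\<And>g. monotone_bf (p + 2) g \<Longrightarrow> P g"
  shows "dist_class (p + 2) P (hard_fn True \<sigma> \<tau> b) \<le> mass / 400"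
proof -
  have \<sigma>: "\<sigma> \<in> codes" using assms(1) by (auto simp: instances_def)
  interpret hard_instance p "action_vars \<sigma>" s k "high_of \<tau>" "ctrl_of \<tau>" by (rule hard_instance_of[OF \<sigma>])
  have "dist_class (p + 2) P (hard_fn True \<sigma> \<tau> b) \<le> bdist (p + 2) (hard True b) (smooth b)"
    unfolding hard_fn_def by (intro dist_class_le P monotone_smooth)
  also have "\<dots> \<le> real (card ids * card (middle_band s k (action_vars \<sigma>))) / 2 ^ (p + 2)"
    by (rule bdist_hard_True_smooth)
  also have "\<dots> \<le> (real (layer_sum (p - 2 * s) l) * (2 ^ (2 * s) / 100)) / 2 ^ (p + 2)"
    using card_middle_band_fraction[OF finite_A A(2) s k_small] card_ids_bounds(1)[OF assms(1)]
    unfolding of_nat_mult by (intro divide_right_mono mult_mono) auto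
  also have "\<dots> = mass / 400" unfolding mass_def cube_size by simp
  finally show ?thesis .
qed

text \<open>49/6400 is the product of 1/16 (good formulas), 1/2 - 1/100 (mismatches above an
  identifier) and 1/4 (switch). Any class \<open>P\<close> between the monotone and the unate
  functions is allowed, which treats both testers at once.\<close>

lemma hard_fn_False_far:
  assumes "(\<sigma>, \<tau>) \<in> instances" and k_small: "200 * real k \<le> sqrt (2 * s)"
    and P: "\<And>g. monotone_bf (p + 2) g \<Longrightarrow> P g" "\<And>g. P g \<Longrightarrow> unate_bf (p + 2) g"
  shows "mass * 49 / 6400 \<le> dist_class (p + 2) P (hard_fn False \<sigma> \<tau> b)"
proof -
  have \<sigma>: "\<sigma> \<in> codes" using assms(1) by (auto simp: instances_def)
  interpret hard_instance p "action_vars \<sigma>" s k "high_of \<tau>" "ctrl_of \<tau>" by (rule hard_instance_of[OF \<sigma>])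
  show ?thesis
    unfolding hard_fn_def
  proof (rule dist_class_ge[where P = P, OF P(1)[OF monotone_smooth]])
    fix g assume "P g"
    have "mass * 49 / 6400 = (real (layer_sum (p - 2 * s) l) / 16) * (2 ^ (2 * s) * (49 / 100)) / 2 ^ (p + 2)"
      unfolding mass_def cube_size by simp
    also have "\<dots> \<le> real (card ids) * (2 ^ (2 * s) / 2 - card (middle_band s k (action_vars \<sigma>))) / 2 ^ (p + 2)"
    proof (intro divide_right_mono mult_mono)
      show "real (layer_sum (p - 2 * s) l) / 16 \<le> real (card ids)"
        using card_ids_bounds(2)[OF assms(1)] by linarith
      show "2 ^ (2 * s) * (49 / 100) \<le> 2 ^ (2 * s) / 2 - real (card (middle_band s k (action_vars \<sigma>)))"
        using card_middle_band_fraction[OF finite_A A(2) s k_small] by simp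
    qed auto
    also have "\<dots> \<le> bdist (p + 2) (hard False b) g"
      by (rule bdist_hard_False[OF P(2)[OF \<open>P g\<close>]])
    finally show "mass * 49 / 6400 \<le> bdist (p + 2) (hard False b) g" .
  qed
qed

lemma tolerant_tester_query_bound:
  assumes T: "nonadaptive_tester (p + 2) q T" "tolerant_tester (p + 2) P (mass / 400) (mass * 49 / 6400) T"
    and k_small: "200 * real k \<le> sqrt (2 * s)"
    and P: "\<And>g. monotone_bf (p + 2) g \<Longrightarrow> P g" "\<And>g. P g \<Longrightarrow> unate_bf (p + 2) g"
  shows "4 ^ k \<le> 48 * real q ^ 2"
proof (rule query_lower_bound[OF T(1)])
  fix \<sigma> \<tau> b assume "(\<sigma>, \<tau>) \<in> instances"
  then show "accept_prob T (hard_fn True \<sigma> \<tau> b) \<ge> 2 / 3" "accept_prob T (hard_fn False \<sigma> \<tau> b) \<le> 1 / 3"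
    using T(2) hard_fn_True_close[where P = P, OF _ k_small P(1)] hard_fn_False_far[where P = P, OF _ k_small P] unfolding tolerant_tester_def by blast+
qed

end

text \<open>48 \<le> 64 gives 2^k \<le> 8q, hence q \<ge> 2^(k-3), and R/1600 - 4 \<ge> R/3200 as
  soon as R \<ge> 12800.\<close>

lemma powr_le_queries:
  fixes R :: real
  assumes R: "R \<ge> 12800" and k: "R / 1600 - 1 \<le> real k" and q: "4 ^ k \<le> 48 * real q ^ 2"
  shows "2 powr (1 / 3200 * R) \<le> real q"
proof -
  have "(2 ^ k)\<^sup>2 = (4::real) ^ k" by (simp add: power2_eq_square flip: power_mult_distrib)
  also have "\<dots> \<le> 64 * (real q)\<^sup>2" using q zero_le_power2[of "real q"] by linarith
  also have "\<dots> = (8 * real q)\<^sup>2" by (simp add: power_mult_distrib)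
  finally have "2 ^ k \<le> 8 * real q" by (rule power2_le_imp_le) simp
  then have "2 powr (real k - 3) \<le> real q"
    by (simp add: powr_diff powr_realpow)
  moreover have "2 powr (1 / 3200 * R) \<le> 2 powr (real k - 3)"
    using R k by (intro powr_mono) auto
  ultimately show ?thesis by linarith
qed

theorem theorem1p1:
  shows "\<exists>\<alpha>1 \<alpha>2 \<beta> \<gamma> :: real. 0 < \<alpha>1 \<and> \<alpha>1 \<le> \<alpha>2 \<and> \<beta> > 0 \<and> \<gamma> > 0 \<and>
    (\<exists>N::nat. \<forall>n\<ge>N. \<forall>\<epsilon>::real. 0 < \<epsilon> \<and> \<epsilon> < 1 \<and> \<epsilon> \<ge> 1 / sqrt (real n) \<longrightarrow>
      (\<exists>\<epsilon>1 \<epsilon>2 :: real. \<alpha>1 * \<epsilon> \<le> \<epsilon>1 \<and> \<epsilon>1 \<le> \<alpha>2 * \<epsilon> \<and> \<epsilon>2 - \<epsilon>1 \<ge> \<beta> * \<epsilon> \<and>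
        (\<forall>q T. nonadaptive_tester n q T \<and> tolerant_tester n (monotone_bf n) \<epsilon>1 \<epsilon>2 T \<longrightarrow>
           real q \<ge> 2 powr (\<gamma> * root 4 (real n) / sqrt \<epsilon>)) \<and>
        (\<forall>q T. nonadaptive_tester n q T \<and> tolerant_tester n (unate_bf n) \<epsilon>1 \<epsilon>2 T \<longrightarrow>
           real q \<ge> 2 powr (\<gamma> * root 4 (real n) / sqrt \<epsilon>))))"
proof -
  have main: "\<exists>\<epsilon>1 \<epsilon>2 :: real. 1 / 6400 * \<epsilon> \<le> \<epsilon>1 \<and> \<epsilon>1 \<le> 1 / 200 * \<epsilon> \<and> \<epsilon>2 - \<epsilon>1 \<ge> 1 / 6400 * \<epsilon> \<and>
        (\<forall>q T. nonadaptive_tester n q T \<and> tolerant_tester n (monotone_bf n) \<epsilon>1 \<epsilon>2 T \<longrightarrow>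
           real q \<ge> 2 powr (1 / 3200 * root 4 (real n) / sqrt \<epsilon>)) \<and>
        (\<forall>q T. nonadaptive_tester n q T \<and> tolerant_tester n (unate_bf n) \<epsilon>1 \<epsilon>2 T \<longrightarrow>
           real q \<ge> 2 powr (1 / 3200 * root 4 (real n) / sqrt \<epsilon>))"
    if n: "12800 ^ 4 \<le> n" and \<epsilon>: "0 < \<epsilon>" "\<epsilon> < 1" "\<epsilon> \<ge> 1 / sqrt (real n)" for n :: nat and \<epsilon> :: real
  proof -
    define x e where "x = sqrt n" "e = \<epsilon> * sqrt n"
    have "real (12800 ^ 4) \<le> real n" using n by (rule of_nat_mono)
    then have "sqrt ((12800\<^sup>2)\<^sup>2) \<le> x" unfolding x_e_def by (intro real_sqrt_le_mono) simp
    then have x: "x \<ge> 12800\<^sup>2" by simp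
    have xx: "x * x = n" and ex: "e = \<epsilon> * x" by (simp_all add: x_e_def)
    have x43: "x \<ge> 43" using x by simp
    have e: "1 \<le> e" "e < x"
      using mult_right_mono[OF \<epsilon>(3), of x] mult_strict_right_mono[OF \<epsilon>(2), of x] x43 n
      unfolding x_e_def by auto
    have x2: "43 * x \<le> x * x" using x43 by (intro mult_right_mono) auto
    \<comment> \<open>The width \<epsilon> sqrt n / 4 makes the layers a \<Theta>(\<epsilon>)
      fraction; the divisor 4 keeps \<open>8 * (l - 1)^2 \<le> c\<close> valid for all \<epsilon> <
      1, and rounding up ensures \<open>l \<ge> 1\<close>.\<close>
    define l where "l = nat \<lceil>e / 4\<rceil>"
    have l: "e / 4 \<le> l" "l < e / 4 + 1" "l \<ge> 1"
      using e unfolding l_def by linarith+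
    define p where "p = n - 2"
    have "n \<ge> 2" using n by simp
    then have np: "n = p + 2" "real p = x * x - 2" unfolding xx by (auto simp: p_def)
    define B where "B = 16 * l + 1"
    have B: "real B \<le> 21 * e" "B \<ge> 17" using l e by (auto simp: B_def)
    have "real (2 * B) = 2 * real B" by simp
    then have "real (2 * B) \<le> real p" using B(1) e x2 x43 np(2) by linarith
    then have pB: "2 * B \<le> p" by (simp only: of_nat_le_iff)
    \<comment> \<open>The largest \<open>s\<close> with \<open>2 * s * B \<le> p\<close>. As s \<ge>
      1, replacing it by s + 1 at most doubles the product, which gives the upper bound in
      \<open>fits\<close>.\<close>
    define s where "s = p div (2 * B)"
    have s1: "s \<ge> 1" using pB B(2) unfolding s_def by (simp add: div_greater_zero_iff Suc_le_eq)
    have s_le: "2 * s * B \<le> p" using div_times_less_eq_dividend[of p "2 * B"] by (simp add: s_def mult_ac)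
    have "p < (s + 1) * (2 * B)"
      using B(2) unfolding s_def by (metis Suc_eq_plus1 dividend_less_div_times less_le_trans mult_Suc
          mult_pos_pos zero_less_numeral add.commute)
    moreover have "(s + 1) * (2 * B) \<le> (2 * s) * (2 * B)" using s1 by (intro mult_le_mono1) linarith
    ultimately have "p \<le> (2 * s) * (2 * B)" by (rule order.trans[OF less_imp_le])
    then have s_ge: "p \<le> 4 * s * B" by (simp add: mult_ac)
    have "real p \<le> real (4 * s * B)" using s_ge by (rule of_nat_mono)
    also have "\<dots> \<le> 4 * real s * (21 * e)" using mult_left_mono[OF B(1), of "4 * real s"] by (simp add: mult_ac)
    finally have "x * x - 2 \<le> 84 * real s * e" unfolding np(2) by simp
    then have "x * x \<le> 100 * real s * e" using x2 x43 by linarith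
    then have "x * x \<le> (100 * real s * \<epsilon>) * x" unfolding ex by (simp add: mult_ac)
    then have "x \<le> 100 * real s * \<epsilon>" by (rule mult_right_le_imp_le) (use x43 in simp)
    then have s_big: "x / \<epsilon> \<le> 50 * (2 * real s)" using \<epsilon> by (simp add: field_simps)
    \<comment> \<open>\<open>R\<close> is n^(1/4) / sqrt \<epsilon>, i.e. sqrt(x/\<epsilon>), and
      \<open>s\<close> is at least of order x/\<epsilon>, so sqrt(2s) is at least of order
      \<open>R\<close>.\<close>
    define R where "R = root 4 (real n) / sqrt \<epsilon>"
    have "root 4 (real n) = sqrt x"
      using real_root_mult_exp[of 2 2 "real n"] by (simp add: sqrt_def x_e_def)
    then have R: "R = sqrt (x / \<epsilon>)" by (simp add: R_def real_sqrt_divide)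
    have "R \<le> sqrt (64 * (2 * real s))"
      unfolding R using s_big by (intro real_sqrt_le_mono) linarith
    also have "\<dots> = 8 * sqrt (2 * real s)"
      using real_sqrt_abs[of 8] by (simp only: real_sqrt_mult[of 64]) simp
    finally have R_s: "R \<le> 8 * sqrt (2 * real s)" .
    have "x \<le> x / \<epsilon>" using \<epsilon> x43 by (simp add: le_divide_eq mult_left_le)
    then have "sqrt (12800\<^sup>2) \<le> R" unfolding R using x by (intro real_sqrt_le_mono) linarith
    then have R_big: "R \<ge> 12800" by simp
    \<comment> \<open>The largest \<open>k\<close> for which the middle band is a fraction of at
      most 1/100; R \<le> 8 sqrt(2s) and R \<ge> 12800 make it positive.\<close>
    define k where "k = nat \<lfloor>sqrt (2 * real s) / 200\<rfloor>"
    have k: "200 * real k \<le> sqrt (2 * s)" "R / 1600 - 1 \<le> real k" "k \<ge> 1"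
      using R_s R_big unfolding k_def by (simp_all, linarith+)
    interpret hp: hard_params p l s k
      by unfold_locales (use l(3) s1 k(3) s_le s_ge in \<open>auto simp: B_def\<close>)
    define c where "c = p - 2 * s"
    have "2 * s * 17 \<le> p" using s_le B(2) by (meson mult_le_mono2 order_trans)
    then have "real c \<ge> 16 / 17 * real p" unfolding c_def by linarith
    then have c: "real c \<ge> x * x / 2" using np(2) x2 x43 by linarith
    have cn: "real c \<le> x * x" using np(2) by (simp add: c_def)
    have "(real l - 1) ^ 2 \<le> (x / 4) ^ 2" using l e by (intro power_mono) auto
    then have "8 * (real l - 1) ^ 2 \<le> c" using c by (simp add: power2_eq_square)
    then have bounds: "hp.mass \<le> l / sqrt c" "l / (4 * sqrt c) \<le> hp.mass"
      using layer_sum_bounds[of c l] hp.parameter_bounds(3) hp.layers_le_half l(3) unfolding hp.mass_def c_def by auto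
    have "sqrt c \<le> x" using cn x43 by (intro real_le_lsqrt) (auto simp: power2_eq_square)
    moreover have "0 < real c" using c x2 x43 by linarith
    then have "0 < sqrt c" by simp
    ultimately have "(e / 4) / (4 * x) \<le> l / (4 * sqrt c)"
      using l e by (intro frac_le) auto
    moreover have "(e / 4) / (4 * x) = \<epsilon> / 16" using x43 by (simp add: ex)
    \<comment> \<open>Together with \<open>mass_hi\<close> this puts \<open>mass\<close> between
      \<epsilon>/16 and 2\<epsilon>. Hence \<epsilon>1 = mass/400 lies between \<epsilon>/6400 and
      \<epsilon>/200, and the gap 33 mass/6400 exceeds \<epsilon>/6400.\<close>
    ultimately have mass_lo: "\<epsilon> / 16 \<le> hp.mass" using bounds(2) by linarith
    have "(7 / 10 * x)\<^sup>2 = 49 / 100 * (x * x)" by (simp add: power2_eq_square)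
    then have "(7 / 10 * x)\<^sup>2 \<le> c" using c x2 x43 by linarith
    then have "7 / 10 * x \<le> sqrt c" by (rule real_le_rsqrt)
    then have "l / sqrt c \<le> (5 / 4 * e) / (7 / 10 * x)"
      using l e x43 by (intro frac_le) auto
    also have "\<dots> \<le> 2 * \<epsilon>" using x43 \<epsilon> by (simp add: ex)
    finally have mass_hi: "hp.mass \<le> 2 * \<epsilon>" using bounds(1) by linarith
    have lower: "2 powr (1 / 3200 * root 4 (real n) / sqrt \<epsilon>) \<le> real q"
      if "nonadaptive_tester n q T" "tolerant_tester n P (hp.mass / 400) (hp.mass * 49 / 6400) T"
        "\<And>g. monotone_bf n g \<Longrightarrow> P g" "\<And>g. P g \<Longrightarrow> unate_bf n g" for q T P
    proof -
      have "4 ^ k \<le> 48 * real q ^ 2"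
        by (rule hp.tolerant_tester_query_bound[of q T P]) (use that k(1) in \<open>simp_all only: np(1)\<close>)
      from powr_le_queries[OF R_big k(2) this] show ?thesis by (simp add: R_def)
    qed
    show ?thesis
    proof (intro exI conjI allI impI)
      show "1 / 6400 * \<epsilon> \<le> hp.mass / 400" "hp.mass / 400 \<le> 1 / 200 * \<epsilon>"
        "1 / 6400 * \<epsilon> \<le> hp.mass * 49 / 6400 - hp.mass / 400"
        using mass_lo mass_hi \<epsilon> by linarith+
    qed (use lower monotone_imp_unate in blast)+
  qed
  show ?thesis
  \<comment> \<open>The threshold 12800^4 for \<open>n\<close> is what yields R \<ge> sqrt(sqrt n)
    \<ge> 12800 for every \<epsilon> < 1.\<close>
  proof (rule exI[of _ "1 / 6400"], rule exI[of _ "1 / 200"], rule exI[of _ "1 / 6400"],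
      rule exI[of _ "1 / 3200"], intro conjI exI[of _ "12800 ^ 4 :: nat"] allI impI)
    fix n :: nat and \<epsilon> :: real
    assume "12800 ^ 4 \<le> n" "0 < \<epsilon> \<and> \<epsilon> < 1 \<and> \<epsilon> \<ge> 1 / sqrt (real n)"
    then show "\<exists>\<epsilon>1 \<epsilon>2 :: real. 1 / 6400 * \<epsilon> \<le> \<epsilon>1 \<and> \<epsilon>1 \<le> 1 / 200 * \<epsilon> \<and> \<epsilon>2 - \<epsilon>1 \<ge> 1 / 6400 * \<epsilon> \<and>
        (\<forall>q T. nonadaptive_tester n q T \<and> tolerant_tester n (monotone_bf n) \<epsilon>1 \<epsilon>2 T \<longrightarrow>
           real q \<ge> 2 powr (1 / 3200 * root 4 (real n) / sqrt \<epsilon>)) \<and>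
        (\<forall>q T. nonadaptive_tester n q T \<and> tolerant_tester n (unate_bf n) \<epsilon>1 \<epsilon>2 T \<longrightarrow>
           real q \<ge> 2 powr (1 / 3200 * root 4 (real n) / sqrt \<epsilon>))"
      by (intro main) simp_all
  qed simp_all
qed

end
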